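(* Let $r\geq 1$ be any natural number. Then \[ \sum_{n\leq x}H(r,n)\sim c(r)\,x(\log x)^{2^r-1} \] as $x\rightarrow\infty$, where \[ c(r)=\frac{1}{(2^r-1)!\,2^r\,r!}\prod_{p\text{ prime}}\left(\left(1+\frac{2^r-1}{p}\right)\left(1-\frac{1}{p}\right)^{2^r-1}\right). \]
   Context: For a polynomial (or formal power series) $f(x)=\sum_{i\ge 0}(f)_i x^i$, $(f)_r$ denotes the coefficient of $x^r$ (which is $0$ if $r$ exceeds the degree of a polynomial $f$). For natural numbers $r,n\ge 1$, \[ H(r,n)=\max\{|(d)_r| : d(x)\in\mathbb{Z}[x],\ d(x)\mid x^n-1\text{ in }\mathbb{Z}[x]\}. \] The sum runs over natural numbers $1\le n\le x$. The notation $A(x)\sim B(x)$ as $x\to\infty$ means $A(x)/B(x)\to 1$. *)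

theory Defs
  imports
    "HOL-Analysis.Analysis"
    "HOL-Computational_Algebra.Computational_Algebra"
    "HOL-Library.Landau_Symbols"
begin

text \<open>
  For \<open>n \<ge> 1\<close> the polynomial \<open>x^n - 1\<close> is nonzero and has only finitely many
  divisors over the integers, so the maximum is taken over a finite nonempty set.
\<close>
definition H :: "nat \<Rightarrow> nat \<Rightarrow> int" where
  "H r n = Max {\<bar>coeff d r\<bar> | d :: int poly. d dvd monom 1 n - 1}"

text \<open>
  The infinite product is taken over the primes in increasing order; non-prime indices
  contribute the factor 1.
\<close>
definition c :: "nat \<Rightarrow> real" where
  "c r = 1 / (fact (2 ^ r - 1) * 2 ^ r * fact r) *
     (\<Prod>p. if prime p
          then (1 + (2 ^ r - 1) / real p) * (1 - 1 / real p) ^ (2 ^ r - 1)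
          else 1)"

end

theory Submission
  imports Defs "HOL-Number_Theory.Totient"
begin

text \<open>
  Let \<open>d\<close> divide \<open>x\<^sup>n - 1\<close>, let \<open>p\<^sub>j\<close> be the sum of the \<open>j\<close>-th powers of the inverse roots of \<open>d\<close>, and
  let \<open>K = 2\<^bsup>\<omega>(n)-1\<^esup>\<close>. The \<open>p\<^sub>j\<close> are integers and are invariant under \<open>j \<mapsto> a j\<close> for \<open>a\<close> coprime to
  \<open>n\<close>; averaging over such \<open>a\<close> gives \<open>\<bar>p\<^sub>j\<bar> \<le> j K\<close>. By Newton's identities the \<open>r\<close>-th coefficient
  of \<open>d\<close> is \<open>\<plusminus>p\<^sub>1\<^sup>r / r! + O(K\<^bsup>r-1\<^esup>)\<close>. As \<open>\<bar>p\<^sub>1\<bar> = K\<close> is attained by the product of the cyclotomic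
  polynomials \<open>\<Phi>\<^sub>m\<close> with \<open>m dvd n\<close> and \<open>\<mu>(m) = 1\<close>, we get \<open>H(r, n) = K\<^sup>r / r! + O(K\<^bsup>r-1\<^esup>)\<close>.

  It remains to sum \<open>k\<^bsup>\<omega>(n)\<^esup>\<close> for \<open>k = 2\<^sup>r\<close>. This function is the Dirichlet convolution of \<open>k\<close>
  copies of the constant function 1 with a function \<open>h\<close> for which \<open>\<Sum> h(n) / n\<close> converges
  absolutely to an Euler product. The first copy of 1 yields a linear main term, and every further
  copy contributes a factor \<open>log x\<close>.
\<close>

section \<open>Power sums over the roots of a divisor of \<open>x\<^sup>n - 1\<close>\<close>

text \<open>The factor 1/2 in \<open>K\<close> decides the constant. The averaging turns
  \<open>p_j\<close> into a sum over the residues coprime to \<open>n\<close>; sieving out a prime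
  \<open>p\<close> of \<open>n\<close> costs a factor \<open>2 (1 - 1/p)\<close>, and the factors
  \<open>1 - 1/p\<close> cancel against \<open>totient n / n\<close>. The 1/2 arises because counts
  of roots in \<open>[0, j]\<close> are within \<open>j / 2\<close> of the midpoint. In Newton's
  recursion a term with \<open>p_j\<close>, \<open>j \<ge> 2\<close>, uses up \<open>j\<close> steps
  of the index but only one factor \<open>K\<close>, so only powers of \<open>p_1\<close> reach the
  order \<open>K ^ r\<close>. Since \<open>K ^ r = (2 ^ r) ^ card (prime_factors n) / 2 ^ r\<close>,
  the constant inherits \<open>1 / (2 ^ r * fact r)\<close>; the factor
  \<open>1 / fact (2 ^ r - 1)\<close> arises because the \<open>i\<close>-th logarithm comes from
  integrating \<open>ln ^ (i - 1)\<close>. The error \<open>K ^ (r - 1)\<close> is averaged like the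
  main term, with \<open>2 ^ (r - 1)\<close> in place of \<open>2 ^ r\<close>, and so has a smaller
  power of \<open>ln x\<close>.\<close>

abbreviation cpoly :: "int poly \<Rightarrow> complex poly" where
  "cpoly \<equiv> map_poly of_int"

lemma cpoly_mult: "cpoly (p * q) = cpoly p * cpoly q"
  by (intro poly_eqI) (simp add: coeff_map_poly coeff_mult)

lemma cpoly_x_pow_minus_1: "cpoly (monom 1 n - 1) = monom 1 n - 1"
  by (intro poly_eqI) (auto simp: coeff_map_poly)

section \<open>Newton's identities for the inverse roots of a divisor\<close>

definition psum :: "complex set \<Rightarrow> nat \<Rightarrow> complex" where
  "psum S j = (\<Sum>s\<in>S. s ^ j)"

text \<open>Logarithmic derivative: each factor \<open>1 - s X\<close> contributes
  \<open>- s / (1 - s X)\<close>, the generating series of the \<open>- s ^ Suc j\<close>.\<close>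

lemma fps_deriv_prod_linear:
  fixes S :: "complex set"
  assumes "finite S"
  shows "fps_deriv (\<Prod>s\<in>S. 1 - fps_const s * fps_X) =
    - (\<Prod>s\<in>S. 1 - fps_const s * fps_X) * Abs_fps (\<lambda>j. psum S (Suc j))"
  using assms
proof induction
  case empty
  have "Abs_fps (\<lambda>j. psum {} (Suc j)) = 0"
    by (simp add: fps_eq_iff psum_def)
  then show ?case by simp
next
  case (insert s S)
  define P where "P = (\<Prod>s\<in>S. 1 - fps_const s * fps_X)"
  define G where "G = Abs_fps (\<lambda>j. s ^ Suc j)"
  have G: "(1 - fps_const s * fps_X) * G = fps_const s"
  proof (rule fps_ext)
    fix k show "((1 - fps_const s * fps_X) * G) $ k = fps_const s $ k"
      by (cases k) (simp_all add: G_def algebra_simps mult.assoc)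
  qed
  have IH: "fps_deriv P = - P * Abs_fps (\<lambda>j. psum S (Suc j))"
    using insert(3) by (simp add: P_def)
  have "Abs_fps (\<lambda>j. psum (insert s S) (Suc j)) = G + Abs_fps (\<lambda>j. psum S (Suc j))"
    using insert by (simp add: fps_eq_iff psum_def G_def)
  moreover have sP: "fps_const s * P = (1 - fps_const s * fps_X) * P * G"
    by (subst G[symmetric]) (simp only: mult_ac)
  moreover have "fps_deriv ((1 - fps_const s * fps_X) * P) =
     - (1 - fps_const s * fps_X) * P * Abs_fps (\<lambda>j. psum S (Suc j)) - fps_const s * P"
    unfolding fps_deriv_mult IH by (simp add: algebra_simps flip: fps_const_neg)
  ultimately show ?case
    unfolding prod.insert[OF insert(1,2)] P_def[symmetric]
    by (simp only: sP minus_mult_left[symmetric] distrib_left) (simp add: mult.assoc)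
qed

text \<open>Comparison of coefficients at \<open>X ^ j\<close> in the logarithmic derivative. With
  inverse roots the recursion starts at the constant coefficient and so governs the low coefficients
  of \<open>D\<close>, whatever its degree.\<close>

lemma newton_identity:
  fixes D :: "complex poly"
  assumes "finite S" and D: "D = smult k (\<Prod>s\<in>S. [:1, -s:])"
  shows "of_nat (Suc j) * coeff D (Suc j) = - (\<Sum>i\<le>j. coeff D i * psum S (Suc j - i))"
proof -
  have "fps_of_poly D = fps_const k * (\<Prod>s\<in>S. 1 - fps_const s * fps_X)"
    unfolding D by (simp add: fps_of_poly_smult fps_of_poly_prod fps_of_poly_pCons mult.commute flip: fps_const_neg)
  then have "fps_deriv (fps_of_poly D) = - fps_of_poly D * Abs_fps (\<lambda>j. psum S (Suc j))"
    using fps_deriv_prod_linear[OF assms(1)] by simp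
  then have "fps_deriv (fps_of_poly D) $ j = (- fps_of_poly D * Abs_fps (\<lambda>j. psum S (Suc j))) $ j"
    by simp
  then show ?thesis
    by (simp add: fps_mult_nth sum_negf atLeast0AtMost Suc_diff_le del: of_nat_Suc)
qed

lemma root_of_divisor:
  fixes d :: "int poly"
  assumes "d dvd monom 1 n - 1" "poly (cpoly d) z = 0"
  shows "z ^ n = 1"
proof -
  obtain g where "monom 1 n - 1 = d * g" using assms(1) by blast
  then have "cpoly d * cpoly g = monom 1 n - 1"
    by (metis cpoly_mult cpoly_x_pow_minus_1)
  then have "poly (monom 1 n - 1) z = 0" using assms(2) by (metis mult_zero_left poly_mult)
  then show ?thesis by (simp add: poly_monom)
qed

text \<open>A double root would be a zero of \<open>n x ^ (n - 1)\<close>, hence 0, which is not an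
  \<open>n\<close>-th root of unity. Simple roots allow the power sums to run over a set.\<close>

lemma rsquarefree_divisor:
  fixes d :: "int poly"
  assumes n: "n > 0" and dvd: "d dvd monom 1 n - 1"
  shows "rsquarefree (cpoly d)"
  unfolding rsquarefree_roots
proof (intro allI notI)
  obtain g where "monom 1 n - 1 = d * g" using dvd by blast
  then have X: "cpoly d * cpoly g = monom 1 n - 1"
    by (metis cpoly_mult cpoly_x_pow_minus_1)
  fix a assume a: "poly (cpoly d) a = 0 \<and> poly (pderiv (cpoly d)) a = 0"
  have "poly (pderiv (monom 1 n - 1)) a = 0"
    using a by (simp flip: X add: pderiv_mult)
  then have "of_nat n * a ^ (n - 1) = 0"
    by (simp add: pderiv_diff pderiv_monom poly_monom)
  then have "a = 0" using n by auto
  with root_of_divisor[OF dvd, of a] a n show False by (simp add: power_0_left)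
qed

lemma coeff_0_divisor:
  fixes d :: "int poly"
  assumes n: "n > 0" and dvd: "d dvd monom 1 n - 1"
  shows "\<bar>coeff d 0\<bar> = 1"
proof -
  obtain g where g: "monom 1 n - 1 = d * g" using dvd by blast
  have "coeff (monom 1 n - 1 :: int poly) 0 = coeff d 0 * coeff g 0"
    unfolding g by (simp add: coeff_mult)
  then have "coeff d 0 * coeff g 0 = -1" using n by simp
  then show ?thesis by (metis abs_mult abs_neg_one abs_zmult_eq_1)
qed

lemma inverse_roots_of_divisor:
  fixes d :: "int poly"
  assumes n: "n > 0" and dvd: "d dvd monom 1 n - 1"
  obtains S where "S \<subseteq> {z. z ^ n = 1}"
    and "cpoly d = smult (of_int (coeff d 0)) (\<Prod>s\<in>S. [:1, -s:])"
proof -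
  note root = root_of_divisor[OF dvd]
  define R where "R = {z. poly (cpoly d) z = 0}"
  define S where "S = inverse ` R"
  have nz: "z \<noteq> 0" if "z \<in> R" for z
    using root[of z] that n by (auto simp: R_def power_0_left)
  have "cpoly d = smult (lead_coeff (cpoly d)) (\<Prod>z\<in>R. [:-z, 1:])"
    using complex_poly_decompose_rsquarefree[OF rsquarefree_divisor[OF assms]] by (simp add: R_def)
  also have "(\<Prod>z\<in>R. [:-z, 1:]) = (\<Prod>z\<in>R. smult (-z) [:1, -inverse z:])"
    by (intro prod.cong) (auto simp: nz)
  also have "\<dots> = smult (\<Prod>z\<in>R. -z) (\<Prod>z\<in>R. [:1, -inverse z:])"
    by (rule prod_smult)
  also have "(\<Prod>z\<in>R. [:1, -inverse z:]) = (\<Prod>s\<in>S. [:1, -s:])"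
    unfolding S_def by (subst prod.reindex) (auto intro: inj_onI)
  finally have "\<exists>k. cpoly d = smult k (\<Prod>s\<in>S. [:1, -s:])"
    unfolding smult_smult by (rule exI)
  then obtain k where k: "cpoly d = smult k (\<Prod>s\<in>S. [:1, -s:])" by (rule exE)
  have "coeff (cpoly d) 0 = k"
    by (subst k) (simp add: coeff_0_prod_list poly_0_coeff_0[symmetric] poly_prod)
  then have "k = of_int (coeff d 0)" by (simp add: coeff_map_poly)
  moreover have "S \<subseteq> {z. z ^ n = 1}"
    using root by (auto simp: S_def R_def power_inverse)
  ultimately show ?thesis using k that by blast
qed

text \<open>Newton's identity for index \<open>j\<close> is solved for \<open>psum S j\<close>,
  whose coefficient is \<open>coeff d 0\<close>, that is, 1 or -1; no division by \<open>j\<close>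
  occurs.\<close>

lemma psum_in_Ints:
  fixes d :: "int poly"
  assumes "finite S" and D: "cpoly d = smult (of_int (coeff d 0)) (\<Prod>s\<in>S. [:1, -s:])"
    and d0: "\<bar>coeff d 0\<bar> = 1"
  shows "psum S j \<in> \<int>"
proof (induction j rule: less_induct)
  case (less j)
  show ?case
  proof (cases j)
    case 0
    then show ?thesis by (simp add: psum_def)
  next
    case (Suc i)
    have "of_nat (Suc i) * of_int (coeff d (Suc i)) =
        - (\<Sum>l\<le>i. of_int (coeff d l) * psum S (Suc i - l))"
      using newton_identity[OF assms(1) D, of i] by (simp add: coeff_map_poly)
    also have "(\<Sum>l\<le>i. of_int (coeff d l) * psum S (Suc i - l)) =
        of_int (coeff d 0) * psum S (Suc i)
        + (\<Sum>l\<in>{..i}-{0}. of_int (coeff d l) * psum S (Suc i - l))"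
      by (subst sum.remove[of _ 0]) auto
    finally have eq: "of_nat (Suc i) * of_int (coeff d (Suc i)) =
        - (of_int (coeff d 0) * psum S (Suc i)
        + (\<Sum>l\<in>{..i}-{0}. of_int (coeff d l) * psum S (Suc i - l)))" .
    have "y = - x - z" if "x = - (y + z)" for x y z :: complex
      using that by simp
    from this[OF eq] have "of_int (coeff d 0) * psum S j = 
       - of_nat (Suc i) * of_int (coeff d (Suc i))
        - (\<Sum>l\<in>{..i}-{0}. of_int (coeff d l) * psum S (Suc i - l))"
      unfolding Suc by (simp only: mult_minus_left)
    also have "\<dots> \<in> \<int>"
      using Suc by (intro Ints_diff Ints_sum Ints_mult Ints_minus less) auto
    finally have *: "of_int (coeff d 0) * psum S j \<in> \<int>" .
    from d0 have "coeff d 0 = 1 \<or> coeff d 0 = -1" by linarith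
    with * show ?thesis by auto
  qed
qed

section \<open>Orthogonality of roots of unity and Frobenius congruences\<close>

lemma sum_power_root_of_unity:
  fixes z :: complex
  assumes "z ^ n = 1"
  shows "(\<Sum>a<n. z ^ a) = (if z = 1 then of_nat n else 0)"
  using assms by (auto simp: geometric_sum)

lemma sum_roots_of_unity_power:
  assumes "n > 0"
  shows "(\<Sum>z::complex | z ^ n = 1. z ^ m) = (if n dvd m then of_nat n else 0)"
proof -
  define w where "w = cis (2 * pi / of_nat n)"
  have w: "cis (2 * pi * real k / real n) = w ^ k" for k
    unfolding w_def Complex.DeMoivre by (simp add: mult_ac)
  have "w ^ n = 1" using assms by (simp add: w[symmetric])
  have inj: "inj_on (\<lambda>k. w ^ k) {..<n}"
    using Complex.bij_betw_roots_unity[OF assms] unfolding w bij_betw_def by blast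
  have red: "w ^ m = w ^ (m mod n)"
    by (metis \<open>w ^ n = 1\<close> div_mult_mod_eq mult_1 power_add power_mult power_one mult.commute)
  have 1: "w ^ m = 1 \<longleftrightarrow> n dvd m"
    unfolding red dvd_eq_mod_eq_0 using inj_on_eq_iff[OF inj, of "m mod n" 0] assms by simp
  have "(\<Sum>z::complex | z ^ n = 1. z ^ m) = (\<Sum>k<n. (w ^ k) ^ m)"
    using sum.reindex_bij_betw[OF Complex.bij_betw_roots_unity[OF assms], of "\<lambda>z. z ^ m"] w by simp
  also have "\<dots> = (\<Sum>k<n. (w ^ m) ^ k)"
    by (simp flip: power_mult add: mult.commute)
  also have "(w ^ m) ^ n = 1"
    by (metis \<open>w ^ n = 1\<close> power_mult power_one mult.commute)
  then have "(\<Sum>k<n. (w ^ m) ^ k) = (if n dvd m then of_nat n else 0)"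
    using 1 sum_power_root_of_unity[of "w ^ m" n] by simp
  finally show ?thesis .
qed

lemma binomial_prime_power:
  fixes a b :: "'a :: comm_ring_1"
  assumes "prime q"
  obtains t where "(a + b) ^ q = a ^ q + b ^ q + of_nat q * t"
proof -
  have q: "q > 1" using assms prime_gt_1_nat by blast
  have "(a + b) ^ q = (\<Sum>k\<le>q. of_nat (q choose k) * a ^ k * b ^ (q - k))"
    by (rule binomial_ring)
  also have "{..q} = insert 0 (insert q {1..<q})" using q by auto
  also have "(\<Sum>k\<in>\<dots>. of_nat (q choose k) * a ^ k * b ^ (q - k)) =
      a ^ q + b ^ q + (\<Sum>k=1..<q. of_nat (q choose k) * a ^ k * b ^ (q - k))"
    using q by (simp add: algebra_simps)
  also have "(\<Sum>k=1..<q. of_nat (q choose k) * a ^ k * b ^ (q - k)) =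
      (\<Sum>k=1..<q. of_nat q * (of_nat ((q choose k) div q) * a ^ k * b ^ (q - k)))"
  proof (intro sum.cong refl)
    fix k assume "k \<in> {1..<q}"
    then have "q dvd (q choose k)" by (intro dvd_choose_prime) (use assms q in auto)
    then have "q * ((q choose k) div q) = q choose k" by simp
    then have "(of_nat (q choose k) :: 'a) = of_nat q * of_nat ((q choose k) div q)"
      by (metis of_nat_mult)
    then show "of_nat (q choose k) * a ^ k * b ^ (q - k) =
       of_nat q * (of_nat ((q choose k) div q) * a ^ k * b ^ (q - k))"
      by (simp add: mult.assoc)
  qed
  finally show ?thesis using that by (simp flip: sum_distrib_left)
qed

lemma fermat_little_int:
  fixes a :: int
  assumes "prime q"
  shows "\<exists>u. a ^ q = a + int q * u"
proof (induction a rule: int_induct[of _ 0])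
  case base
  then show ?case using prime_gt_0_nat[OF assms] by (intro exI[of _ 0]) (simp add: power_0_left)
next
  case (step1 a)
  then obtain u where u: "a ^ q = a + int q * u" by blast
  obtain t where "(a + 1) ^ q = a ^ q + 1 ^ q + of_nat q * t"
    using binomial_prime_power[OF assms] by blast
  with u show ?case by (intro exI[of _ "u + t"]) (simp add: algebra_simps)
next
  case (step2 a)
  then obtain u where u: "a ^ q = a + int q * u" by blast
  obtain t where "((a - 1) + 1) ^ q = (a - 1) ^ q + 1 ^ q + of_nat q * t"
    using binomial_prime_power[OF assms] by blast
  with u show ?case by (intro exI[of _ "u - t"]) (simp add: algebra_simps)
qed

lemma int_poly_frobenius:
  fixes Q :: "int poly"
  assumes "prime q"
  shows "\<exists>G. Q ^ q = pcompose Q (monom 1 q) + of_nat q * G"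
proof (induction Q)
  case 0
  then show ?case using prime_gt_0_nat[OF assms] by (intro exI[of _ 0]) (simp add: power_0_left)
next
  case (pCons a Q)
  from pCons obtain G where G: "Q ^ q = pcompose Q (monom 1 q) + of_nat q * G" by blast
  obtain t where t: "([:a:] + [:0,1:] * Q) ^ q = [:a:] ^ q + ([:0,1:] * Q) ^ q + of_nat q * t"
    using binomial_prime_power[OF assms] by blast
  obtain u where u: "a ^ q = a + int q * u" using fermat_little_int[OF assms] by blast
  have "pCons a Q = [:a:] + [:0,1:] * Q" by simp
  then have "pCons a Q ^ q = [:a ^ q:] + monom 1 q * Q ^ q + of_nat q * t"
    unfolding t[symmetric] by (simp only: t power_mult_distrib poly_const_pow monom_altdef smult_1_left)
  also have "\<dots> = pcompose (pCons a Q) (monom 1 q) + of_nat q * ([:u:] + monom 1 q * G + t)"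
    unfolding G u by (simp add: pcompose_pCons algebra_simps of_nat_poly)
  finally show ?case by blast
qed

lemma cpoly_pcompose: "cpoly (pcompose p q) = pcompose (cpoly p) (cpoly q)"
proof (induction p)
  case (pCons a p)
  have "cpoly ([:a:] + r) = [:of_int a:] + cpoly r" for r
    by (intro poly_eqI) (simp add: coeff_map_poly coeff_pCons split: nat.splits)
  with pCons show ?case by (simp add: pcompose_pCons map_poly_pCons cpoly_mult)
qed simp

lemma psum_power_add:
  assumes "S \<subseteq> {z. z ^ n = 1}" "i mod n = j mod n"
  shows "psum S i = psum S j"
  unfolding psum_def
proof (intro sum.cong refl)
  fix s assume "s \<in> S"
  then have s: "s ^ n = 1" using assms by auto
  have "s ^ k = s ^ (k mod n)" for k
    by (metis s div_mult_mod_eq mult_1 power_add power_mult power_one mult.commute)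
  then show "s ^ i = s ^ j" using assms(2) by metis
qed

text \<open>Orthogonality: the discrete Fourier transform of
  \<open>a \<mapsto> psum S (j * a)\<close> is \<open>n\<close> times a count of roots. For
  \<open>j = 1\<close> the count is 0 or 1, as the Frobenius argument needs; in general it is at
  most \<open>j\<close>, as the sieve needs.\<close>

lemma sum_psum_times_root:
  assumes S: "S \<subseteq> {z. z ^ n = 1}" "finite S" and z: "z ^ n = 1"
  shows "(\<Sum>a<n. psum S (j * a) * z ^ a) = of_nat n * of_nat (card {s\<in>S. s ^ j * z = 1})"
proof -
  have "(\<Sum>a<n. psum S (j * a) * z ^ a) = (\<Sum>s\<in>S. \<Sum>a<n. (s ^ j * z) ^ a)"
    unfolding psum_def sum_distrib_right by (subst sum.swap) (simp add: power_mult power_mult_distrib)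
  also have "\<dots> = (\<Sum>s\<in>S. if s ^ j * z = 1 then of_nat n else 0)"
  proof (intro sum.cong refl sum_power_root_of_unity)
    fix s assume "s \<in> S"
    then have "s ^ n = 1" using S by auto
    then show "(s ^ j * z) ^ n = 1"
      using z by (metis mult_1 power_commutes power_mult power_mult_distrib power_one mult.commute)
  qed
  also have "\<dots> = of_nat n * of_nat (card {s\<in>S. s ^ j * z = 1})"
    using S(2) by (simp add: sum.If_cases Int_def)
  finally show ?thesis .
qed

text \<open>
  The polynomial \<open>\<Sum>i<n. P i x\<^sup>i\<close> takes the value \<open>n\<close> or 0 at every \<open>n\<close>-th root of unity, so it is \<open>n\<close>
  times an idempotent modulo \<open>x\<^sup>n - 1\<close>; comparing its \<open>q\<close>-th power with the Frobenius map modulo \<open>q\<close>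
  gives the congruence.
\<close>
lemma psum_prime_cong:
  assumes n: "n > 0" and S: "S \<subseteq> {z. z ^ n = 1}" and P: "\<And>j. psum S j = of_int (P j)"
    and q: "prime q" "coprime q n"
  shows "\<exists>t. int n ^ (q - 1) * P (q * j) = P j + int q * t"
proof -
  define U where "U = {z::complex. z ^ n = 1}"
  have finU: "finite U" unfolding U_def using n by (intro finite_roots_unity) simp
  have finS: "finite S" using S finU finite_subset unfolding U_def by blast
  have Pmod: "P i = P k" if "i mod n = k mod n" for i k
    using psum_power_add[OF S that] by (simp add: P)
  define Q where "Q = (\<Sum>i<n. monom (P i) i)"
  obtain G where G: "Q ^ q = pcompose Q (monom 1 q) + of_nat q * G"
    using int_poly_frobenius[OF q(1)] by blast
  have evQ: "poly (cpoly Q) z = (\<Sum>i<n. of_int (P i) * z ^ i)" for z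
  proof -
    have "cpoly Q = (\<Sum>i<n. monom (of_int (P i)) i)"
      unfolding Q_def by (intro poly_eqI) (auto simp: coeff_map_poly coeff_sum of_int_sum intro!: sum.cong)
    then show ?thesis by (simp add: poly_sum poly_monom)
  qed
  have cpow: "cpoly (Q ^ k) = cpoly Q ^ k" for k
    by (induction k) (simp_all add: cpoly_mult)
  have ev: "of_nat n ^ (q - 1) * poly (cpoly Q) z = poly (cpoly Q) (z ^ q) + of_nat q * poly (cpoly G) z"
    if z: "z \<in> U" for z
  proof -
    define k where "k = card {s\<in>S. s * z = 1}"
    have "s = inverse z" if "s * z = 1" for s
      using that by (metis inverse_unique mult.commute)
    then have "{s\<in>S. s * z = 1} \<subseteq> {inverse z}" by auto
    then have "k \<le> 1" unfolding k_def by (metis card_mono card_1_singleton_iff finite.emptyI finite_insert One_nat_def)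
    then have kk: "of_nat k ^ q = (of_nat k :: complex)" 
      using prime_gt_0_nat[OF q(1)] by (cases k) auto
    have Qz: "poly (cpoly Q) z = of_nat n * of_nat k"
      using sum_psum_times_root[OF S finS, of z 1] z unfolding evQ k_def
      by (simp add: U_def P)
    have "of_nat n ^ (q - 1) * poly (cpoly Q) z = of_nat n ^ q * of_nat k ^ q"
      unfolding Qz kk using prime_gt_0_nat[OF q(1)] 
      by (metis mult.assoc power_minus_mult)
    also have "\<dots> = poly (cpoly Q) z ^ q" by (simp add: Qz power_mult_distrib)
    also have "\<dots> = poly (cpoly (Q ^ q)) z" by (simp add: cpow)
    also have "cpoly (Q ^ q) = pcompose (cpoly Q) (monom 1 q) + of_nat q * cpoly G"
    proof -
      have "cpoly (a + b) = cpoly a + cpoly b" for a b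
        by (intro poly_eqI) (simp add: coeff_map_poly)
      moreover have "cpoly (of_nat q * G) = of_nat q * cpoly G"
        by (simp add: cpoly_mult of_nat_poly) (intro poly_eqI, simp add: coeff_map_poly)
      moreover have "cpoly (pcompose Q (monom 1 q)) = pcompose (cpoly Q) (monom 1 q)"
        by (simp add: cpoly_pcompose map_poly_monom)
      ultimately show ?thesis unfolding G by simp
    qed
    finally show ?thesis by (simp add: poly_pcompose poly_monom)
  qed
  \<comment> \<open>\<open>m\<close> represents \<open>- q * j\<close> modulo \<open>n\<close>
    without subtraction; multiplying by \<open>z ^ m\<close> and summing over all roots of unity
    extracts the coefficients whose index is congruent to \<open>q * j\<close>.\<close>
  define m where "m = (n - 1) * (q * j)"
  have dvdm: "n dvd i + m \<longleftrightarrow> i mod n = (q * j) mod n" for i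
  proof -
    have "m + q * j = n * (q * j)" using n by (simp add: m_def algebra_simps)
    then have "n dvd i + m \<longleftrightarrow> [i + m = q * j + m] (mod n)"
      by (simp add: cong_def dvd_eq_mod_eq_0 add.commute)
    then show ?thesis using cong_add_rcancel_nat[of i m "q * j" n] by (simp add: cong_def)
  qed
  have pick: "(\<Sum>z\<in>U. (\<Sum>i<k. of_int (f i) * z ^ (l * i)) * z ^ m) =
      (of_nat n * of_int (\<Sum>i | i < k \<and> (l * i) mod n = (q * j) mod n. f i) :: complex)" for f k l
  proof -
    have "(\<Sum>z\<in>U. (\<Sum>i<k. of_int (f i) * z ^ (l * i)) * z ^ m) =
        (\<Sum>i<k. of_int (f i) * (\<Sum>z\<in>U. z ^ (l * i + m)))"
      unfolding sum_distrib_right sum_distrib_left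
      by (subst sum.swap) (simp only: power_add mult.assoc)
    also have "\<dots> = (\<Sum>i<k. if (l * i) mod n = (q * j) mod n then of_nat n * of_int (f i) else 0)"
      unfolding U_def sum_roots_of_unity_power[OF n] dvdm by (intro sum.cong) auto
    also have "\<dots> = of_nat n * of_int (\<Sum>i | i < k \<and> (l * i) mod n = (q * j) mod n. f i)"
      by (simp add: sum.If_cases Int_def sum_distrib_left)
    finally show ?thesis .
  qed
  have pcG: "poly (cpoly G) z = (\<Sum>i<Suc (degree G). of_int (coeff G i) * z ^ (1 * i))" for z
  proof -
    have "degree (cpoly G) = degree G" by (rule degree_map_poly) auto
    then show ?thesis by (simp add: poly_altdef coeff_map_poly lessThan_Suc_atMost)
  qed
  have "(\<Sum>z\<in>U. (of_nat n ^ (q - 1) * poly (cpoly Q) z) * z ^ m) =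
        (\<Sum>z\<in>U. poly (cpoly Q) (z ^ q) * z ^ m) + of_nat q * (\<Sum>z\<in>U. poly (cpoly G) z * z ^ m)"
  proof -
    have "(\<Sum>z\<in>U. (of_nat n ^ (q - 1) * poly (cpoly Q) z) * z ^ m) =
        (\<Sum>z\<in>U. poly (cpoly Q) (z ^ q) * z ^ m + of_nat q * (poly (cpoly G) z * z ^ m))"
      by (intro sum.cong refl) (simp only: ev distrib_right mult.assoc)
    then show ?thesis by (simp only: sum.distrib sum_distrib_left)
  qed
  also have "(\<Sum>z\<in>U. (of_nat n ^ (q - 1) * poly (cpoly Q) z) * z ^ m) =
     of_nat n ^ (q - 1) * (\<Sum>z\<in>U. (\<Sum>i<n. of_int (P i) * z ^ (1 * i)) * z ^ m)"
    by (simp only: evQ mult.assoc sum_distrib_left[symmetric] mult_1)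
  also have "(\<Sum>z\<in>U. poly (cpoly Q) (z ^ q) * z ^ m) = 
    (\<Sum>z\<in>U. (\<Sum>i<n. of_int (P i) * z ^ (q * i)) * z ^ m)"
    by (simp add: evQ power_mult)
  finally have *: "of_nat n ^ (q - 1) * (of_nat n * of_int (\<Sum>i | i < n \<and> (1 * i) mod n = (q * j) mod n. P i)) =
    of_nat n * of_int (\<Sum>i | i < n \<and> (q * i) mod n = (q * j) mod n. P i) + 
    of_nat q * (of_nat n * (of_int (\<Sum>i | i < Suc (degree G) \<and> (1 * i) mod n = (q * j) mod n. coeff G i) :: complex))"
    unfolding pcG pick .
  have e1: "{i. i < n \<and> (1 * i) mod n = (q * j) mod n} = {(q * j) mod n}" using n by auto
  have cancel: "(q * i) mod n = (q * j) mod n \<longleftrightarrow> i mod n = j mod n" for i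
    using cong_mult_lcancel_nat[OF q(2), of i j] by (simp add: cong_def)
  have e2: "{i. i < n \<and> (q * i) mod n = (q * j) mod n} = {j mod n}"
    unfolding cancel using n by auto
  have e3: "P ((q * j) mod n) = P (q * j)" "P (j mod n) = P j"
    by (rule Pmod, simp)+
  have singleton: "sum P {i} = P i" for i by simp
  \<comment> \<open>\<open>G\<close> may have degree \<open>n\<close> or more, so several
    coefficients can fall into the class of \<open>q * j\<close>; only the integrality of their sum
    matters.\<close>
  define t where "t = (\<Sum>i | i < Suc (degree G) \<and> (1 * i) mod n = (q * j) mod n. coeff G i)"
  have "of_nat n ^ (q - 1) * (of_nat n * of_int (P (q * j))) =
    of_nat n * of_int (P j) + of_nat q * (of_nat n * (of_int t :: complex))"
    using * unfolding e1 e2 t_def[symmetric] singleton e3 .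
  then have "of_nat n * (of_int (int n ^ (q - 1) * P (q * j)) :: complex) = of_nat n * of_int (P j + int q * t)"
    by (simp add: algebra_simps)
  then have "int n ^ (q - 1) * P (q * j) = P j + int q * t"
    using n by (simp only: mult_cancel_left of_int_eq_iff) simp
  then show ?thesis by blast
qed

text \<open>Fermat's \<open>n ^ q = n\<close> modulo \<open>q\<close> turns the congruence into
  \<open>P (q * j) = P j\<close> modulo \<open>q\<close>. Both values are at most \<open>n\<close>
  in absolute value, so \<open>q > 2 * n\<close> forces equality.\<close>

lemma psum_large_prime:
  assumes n: "n > 0" and S: "S \<subseteq> {z. z ^ n = 1}" and I: "\<And>j. psum S j \<in> \<int>"
    and q: "prime q" "q > 2 * n"
  shows "psum S (q * j) = psum S j"
proof -
  define P where "P j = (SOME k. psum S j = of_int k)" for j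
  have P: "psum S j = of_int (P j)" for j
    unfolding P_def by (rule someI_ex) (metis I Ints_cases)
  have nq: "\<not> q dvd n" using n q(2) by (auto dest: dvd_imp_le)
  then have cop: "coprime q n" using q(1) prime_imp_coprime by blast
  obtain t where t: "int n ^ (q - 1) * P (q * j) = P j + int q * t"
    using psum_prime_cong[OF n S P q(1) cop] by blast
  obtain u where u: "int n ^ q = int n + int q * u" using fermat_little_int[OF q(1)] by blast
  have "int n ^ q = int n ^ (q - 1) * int n" 
    using prime_gt_0_nat[OF q(1)] by (metis power_minus_mult)
  then have "(int n + int q * u) * P (q * j) = int n * (int n ^ (q - 1) * P (q * j))"
    unfolding u[symmetric] by simp
  then have "int n * (P (q * j) - P j) = int q * (int n * t - u * P (q * j))"
    unfolding t by (simp add: algebra_simps)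
  then have "int q dvd int n * (P (q * j) - P j)" by simp
  then have dvd: "int q dvd P (q * j) - P j"
    using cop by (simp add: coprime_dvd_mult_right_iff)
  have finU: "finite {z::complex. z ^ n = 1}" using n by (intro finite_roots_unity) simp
  have "\<bar>P i\<bar> \<le> int n" for i
  proof -
    have "norm (psum S i) \<le> (\<Sum>s\<in>S. norm (s ^ i))"
      unfolding psum_def by (rule norm_sum)
    also have "\<dots> \<le> (\<Sum>s\<in>S. 1)"
    proof (intro sum_mono)
      fix s assume "s \<in> S"
      then have "norm s ^ n = 1" using S by (auto simp flip: norm_power)
      then have "norm s = 1" using n power_eq_imp_eq_base[of "norm s" n 1] by simp
      then show "norm (s ^ i) \<le> 1" by (simp add: norm_power)
    qed
    also have "\<dots> \<le> real n"
      using card_mono[OF finU S] Complex.card_roots_unity_eq[OF n] by simp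
    finally show ?thesis by (simp add: P)
  qed
  from this[of "q * j"] this[of j] have "\<bar>P (q * j) - P j\<bar> < int q" using q(2) by linarith
  with dvd have "P (q * j) = P j" using dvd_imp_le_int[of "P (q * j) - P j" "int q"] by linarith
  then show ?thesis by (simp add: P)
qed

lemma psum_rough:
  assumes n: "n > 0" and S: "S \<subseteq> {z. z ^ n = 1}" and I: "\<And>j. psum S j \<in> \<int>"
    and "A > 0" "\<And>q. prime q \<Longrightarrow> q dvd A \<Longrightarrow> q > 2 * n"
  shows "psum S (A * j) = psum S j"
  using assms(4,5)
proof (induction A arbitrary: j rule: less_induct)
  case (less A)
  show ?case
  proof (cases "A = 1")
    case False
    then obtain q where q: "prime q" "q dvd A" using prime_factor_nat by blast
    then obtain B where B: "A = q * B" by blast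
    have "B > 0" "B < A" using less(2) B prime_gt_1_nat[OF q(1)] by auto
    have "psum S (A * j) = psum S (q * (B * j))" by (simp add: B mult.assoc)
    also have "\<dots> = psum S (B * j)" using psum_large_prime[OF n S I q(1)] less(3) q by blast
    also have "\<dots> = psum S j" using less B \<open>B > 0\<close> \<open>B < A\<close> by simp
    finally show ?thesis .
  qed simp
qed

text \<open>
  Every residue class coprime to \<open>n\<close> contains a number without small prime factors, which
  replaces an appeal to the irreducibility of cyclotomic polynomials.
\<close>
lemma psum_coprime:
  assumes n: "n > 0" and S: "S \<subseteq> {z. z ^ n = 1}" and I: "\<And>j. psum S j \<in> \<int>"
    and a: "coprime a n"
  shows "psum S (a * j) = psum S j"
proof -
  define T where "T = {p. prime p \<and> p \<le> 2 * n \<and> \<not> p dvd a}"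
  have finT: "finite T" by (rule finite_subset[of _ "{..2*n}"]) (auto simp: T_def)
  \<comment> \<open>Each prime up to \<open>2 * n\<close> divides exactly one of the two summands,
    hence not \<open>A\<close>: those dividing \<open>a\<close> do not divide \<open>n\<close> and
    are excluded from \<open>T\<close>, all others lie in \<open>T\<close>.\<close>
  define A where "A = a + n * \<Prod>T"
  have rough: "q > 2 * n" if q: "prime q" "q dvd A" for q
  proof (rule ccontr)
    assume "\<not> q > 2 * n"
    show False
    proof (cases "q dvd a")
      case True
      then have "q dvd n * \<Prod>T" using q(2) by (simp add: A_def dvd_add_right_iff)
      moreover have "\<not> q dvd n" using True a q(1) by (metis coprime_common_divisor not_prime_unit)
      ultimately have "q dvd \<Prod>T" using q(1) prime_dvd_mult_iff by blast
      then obtain p where "p \<in> T" "q dvd p" using q(1) finT by (auto simp: prime_dvd_prod_iff)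
      then have "q = p" using q(1) by (simp add: T_def primes_dvd_imp_eq)
      then show False using True \<open>p \<in> T\<close> by (simp add: T_def)
    next
      case False
      then have "q \<in> T" using q \<open>\<not> q > 2 * n\<close> by (simp add: T_def)
      then have "q dvd n * \<Prod>T" using dvd_prodI[OF finT, of q "\<lambda>x. x"] by simp
      then show False using q(2) False by (simp add: A_def dvd_add_left_iff)
    qed
  qed
  have "\<Prod>T > 0" by (intro prod_pos) (auto simp: T_def prime_gt_0_nat)
  then have "A > 0" using n by (simp add: A_def)
  have "psum S (a * j) = psum S (A * j)"
  proof (rule psum_power_add[OF S])
    have "A * j = a * j + n * (\<Prod>T * j)" by (simp add: A_def algebra_simps)
    then show "a * j mod n = A * j mod n" by simp
  qed
  then show ?thesis using psum_rough[OF n S I \<open>A > 0\<close> rough] by simp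
qed

text \<open>
  The indicator of \<open>T\<close>-free integers is a product of the functions \<open>1 - [p dvd a]\<close>, each of
  which is a combination of characters with coefficients of total mass \<open>2 (1 - 1/p)\<close> and of
  sum 0. Centering at \<open>n * M / 2\<close> is what saves the factor 2 in the bound for \<open>psum\<close>.
\<close>
lemma sieved_sum_bound:
  fixes g :: "nat \<Rightarrow> complex"
  assumes n: "n > 0"
    and g: "\<And>z. z ^ n = 1 \<Longrightarrow> \<exists>k::nat. real k \<le> M \<and> (\<Sum>a<n. g a * z ^ a) = of_nat n * of_nat k"
    and T: "finite T" "\<And>p. p \<in> T \<Longrightarrow> prime p \<and> p dvd n"
    and z: "z ^ n = 1"
  shows "norm ((\<Sum>a<n. (if \<exists>p\<in>T. p dvd a then 0 else g a) * z ^ a)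
      - (if T = {} then of_real (n * M / 2) else 0)) \<le> (n * M / 2) * (\<Prod>p\<in>T. 2 * (1 - 1 / real p))"
  using T z
proof (induction T arbitrary: z rule: finite_induct)
  case empty
  obtain k :: nat where k: "real k \<le> M" "(\<Sum>a<n. g a * z ^ a) = of_nat n * of_nat k"
    using g empty.prems by blast
  have "norm ((of_nat n * of_nat k :: complex) - of_real (n * M / 2)) = \<bar>real n * real k - n * M / 2\<bar>"
  proof -
    have "(of_nat n * of_nat k :: complex) - of_real (n * M / 2) = of_real (real n * real k - n * M / 2)"
      by simp
    then show ?thesis by (simp only: norm_of_real)
  qed
  also have "\<dots> = real n * \<bar>real k - M / 2\<bar>"
  proof -
    have "real n * real k - n * M / 2 = real n * (real k - M / 2)" by (simp add: algebra_simps)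
    then show ?thesis by (simp only: abs_mult abs_of_nat)
  qed
  also have "\<dots> \<le> real n * (M / 2)"
  proof (rule mult_left_mono)
    show "\<bar>real k - M / 2\<bar> \<le> M / 2"
      using k(1) of_nat_0_le_iff[of k] unfolding abs_le_iff by linarith
  qed simp
  finally show ?case using k(2) by simp
next
  case (insert p T)
  define X where "X z = (\<Sum>a<n. (if \<exists>p\<in>T. p dvd a then 0 else g a) * z ^ a)" for z
  define C where "C = (if T = {} then complex_of_real (n * M / 2) else 0)"
  define B where "B = (n * M / 2) * (\<Prod>p\<in>T. 2 * (1 - 1 / real p))"
  define W where "W = {w::complex. w ^ p = 1}"
  have IH: "norm (X u - C) \<le> B" if "u ^ n = 1" for u
    unfolding X_def C_def B_def using insert.IH[of u] insert.prems that by auto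
  have p: "prime p" "p dvd n" using insert.prems by auto
  have p0: "p > 0" using p(1) by (rule prime_gt_0_nat)
  have cardW: "card W = p" unfolding W_def using p0 by (rule Complex.card_roots_unity_eq)
  then have finW: "finite W" using p0 card_ge_0_finite by blast
  have oneW: "1 \<in> W" by (simp add: W_def)
  have zW: "(z * w) ^ n = 1" if "w \<in> W" for w
  proof -
    obtain k where "n = p * k" using p(2) by blast
    with that have "w ^ n = 1" by (simp add: W_def power_mult)
    then show ?thesis using insert.prems(2) by (simp add: power_mult_distrib)
  qed
  define A where "A = (\<lambda>a. (if \<exists>p\<in>T. p dvd a then 0 else g a) * z ^ a)"
  \<comment> \<open>Averaging over the twists of \<open>z\<close> by \<open>p\<close>-th roots of
    unity keeps exactly the terms with \<open>p dvd a\<close>. As \<open>p dvd n\<close>, the twists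
    are \<open>n\<close>-th roots of unity again, so the induction hypothesis applies to
    them.\<close>
  have "(\<Sum>w\<in>W. X (z * w)) = (\<Sum>a<n. A a * (\<Sum>w\<in>W. w ^ a))"
    unfolding X_def A_def sum_distrib_left
    by (subst sum.swap) (simp add: power_mult_distrib mult.assoc)
  also have "\<dots> = (\<Sum>a<n. of_nat p * (A a * (if p dvd a then 1 else 0)))"
    unfolding W_def sum_roots_of_unity_power[OF p0] by (intro sum.cong) auto
  also have "\<dots> = of_nat p * (\<Sum>a<n. A a * (if p dvd a then 1 else 0))"
    by (simp only: sum_distrib_left)
  finally have 1: "(\<Sum>a<n. A a * (if p dvd a then 1 else 0)) = (\<Sum>w\<in>W. X (z * w)) / of_nat p"
    using p0 by simp
  have "(\<Sum>a<n. (if \<exists>p\<in>insert p T. p dvd a then 0 else g a) * z ^ a)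
      = (\<Sum>a<n. A a - A a * (if p dvd a then 1 else 0))"
    unfolding A_def by (intro sum.cong) auto
  also have "\<dots> = X z - (\<Sum>w\<in>W. X (z * w)) / of_nat p"
    unfolding sum_subtractf 1 by (simp add: X_def A_def)
  also have "(\<Sum>w\<in>W. X (z * w)) = X z + (\<Sum>w\<in>W-{1}. X (z * w))"
    using sum.remove[OF finW oneW, of "\<lambda>w. X (z * w)"] by simp
  also have "(\<Sum>w\<in>W-{1}. X (z * w)) = (\<Sum>w\<in>W-{1}. X (z * w) - C) + of_nat (p - 1) * C"
    using finW oneW cardW by (simp add: sum_subtractf)
  \<comment> \<open>The weights \<open>1 - 1/p\<close> at \<open>w = 1\<close> and
    \<open>- 1/p\<close> at the other \<open>p - 1\<close> twists sum to 0, so the constant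
    \<open>C\<close> cancels; hence the correction term is present only for
    \<open>T = {}\<close>.\<close>
  also have "X z - (X z + ((\<Sum>w\<in>W-{1}. X (z * w) - C) + of_nat (p - 1) * C)) / of_nat p =
      of_real (1 - 1 / real p) * (X z - C) - (\<Sum>w\<in>W-{1}. X (z * w) - C) / of_nat p"
    using p0 by (simp add: field_simps of_nat_diff)
  finally have eq: "(\<Sum>a<n. (if \<exists>p\<in>insert p T. p dvd a then 0 else g a) * z ^ a) =
     of_real (1 - 1 / real p) * (X z - C) - (\<Sum>w\<in>W-{1}. X (z * w) - C) / of_nat p" .
  have "norm (of_real (1 - 1 / real p) * (X z - C)) \<le> (1 - 1 / real p) * B"
    using p0 IH[OF insert.prems(2)] unfolding norm_mult norm_of_real by (intro mult_mono) auto
  moreover have "norm ((\<Sum>w\<in>W-{1}. X (z * w) - C) / of_nat p) \<le> (1 - 1 / real p) * B"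
  proof -
    have "norm (\<Sum>w\<in>W-{1}. X (z * w) - C) \<le> of_nat (card (W - {1})) * B"
      by (rule sum_norm_bound) (use IH zW in auto)
    also have "card (W - {1}) = p - 1" using finW oneW cardW by simp
    finally show ?thesis using p0 by (simp add: norm_divide divide_simps of_nat_diff mult_ac)
  qed
  ultimately have "norm (\<Sum>a<n. (if \<exists>p\<in>insert p T. p dvd a then 0 else g a) * z ^ a)
     \<le> (1 - 1 / real p) * B + (1 - 1 / real p) * B"
    unfolding eq by (rule order.trans[OF norm_triangle_ineq4 add_mono])
  also have "\<dots> = (n * M / 2) * (\<Prod>p\<in>insert p T. 2 * (1 - 1 / real p))"
    using insert.hyps by (simp add: B_def)
  finally show ?case by simp
qed

text \<open>The sieve with \<open>M = j\<close> and \<open>z = 1\<close>, applied to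
  \<open>a \<mapsto> psum S (j * a)\<close>, sums the same value over all reduced residues and so
  computes \<open>totient n * psum S j\<close>; the product formula for \<open>totient n\<close>
  then cancels. As \<open>n > 1\<close>, there is a prime to sieve by, so the centering term is
  absent.\<close>

lemma norm_psum_le:
  assumes n: "n > 1" and S: "S \<subseteq> {z. z ^ n = 1}" and I: "\<And>j. psum S j \<in> \<int>" and j: "j > 0"
  shows "norm (psum S j) \<le> real j * 2 ^ card (prime_factors n) / 2"
proof -
  have n0: "n > 0" using n by simp
  have finS: "finite S" using S finite_subset finite_roots_unity[of n] n0 by auto
  let ?T = "prime_factors n"
  have neT: "?T \<noteq> {}" using prime_factor_nat[of n] n by (auto simp: prime_factors_dvd)
  have cnt: "\<exists>k::nat. real k \<le> real j \<and> (\<Sum>a<n. psum S (j * a) * z ^ a) = of_nat n * of_nat k"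
    if z: "z ^ n = 1" for z
  proof (intro exI conjI)
    show "(\<Sum>a<n. psum S (j * a) * z ^ a) = of_nat n * of_nat (card {s\<in>S. s ^ j * z = 1})"
      by (rule sum_psum_times_root[OF S finS z])
    have z0: "z \<noteq> 0" using z n0 by (auto simp: power_0_left)
    \<comment> \<open>Solutions are \<open>j\<close>-th roots of \<open>inverse z\<close>, so there
      are at most \<open>j\<close>; this is the source of the factor \<open>j\<close> in the
      bound.\<close>
    then have "{s\<in>S. s ^ j * z = 1} \<subseteq> {s. s ^ j = inverse z}"
      by (auto simp: field_simps)
    then have "card {s\<in>S. s ^ j * z = 1} \<le> card {s. s ^ j = inverse z}"
      using finite_nth_roots[OF j] by (intro card_mono) auto
    also have "\<dots> = j" using j z0 by (intro card_nth_roots) auto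
    finally show "real (card {s\<in>S. s ^ j * z = 1}) \<le> real j" by simp
  qed
  have "norm ((\<Sum>a<n. (if \<exists>p\<in>?T. p dvd a then 0 else psum S (j * a)) * 1 ^ a)
      - (if ?T = {} then of_real (n * real j / 2) else 0)) \<le> (n * real j / 2) * (\<Prod>p\<in>?T. 2 * (1 - 1 / real p))"
    by (rule sieved_sum_bound[OF n0 cnt]) (auto simp: prime_factors_dvd)
  moreover have "(\<Sum>a<n. (if \<exists>p\<in>?T. p dvd a then 0 else psum S (j * a)) * 1 ^ a) = 
      of_nat (totient n) * psum S j"
  proof -
    have *: "(\<exists>p\<in>?T. p dvd a) \<longleftrightarrow> \<not> coprime a n" for a
    proof
      assume "\<not> coprime a n"
      then have "gcd a n \<noteq> 1" by (simp add: coprime_iff_gcd_eq_1)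
      then obtain p where "prime p" "p dvd gcd a n" using prime_factor_nat by blast
      then show "\<exists>p\<in>?T. p dvd a" using n0 by (auto simp: prime_factors_dvd)
    qed (auto simp: prime_factors_dvd dest: coprime_common_divisor not_prime_unit)
    have "(\<Sum>a<n. (if \<exists>p\<in>?T. p dvd a then 0 else psum S (j * a)) * 1 ^ a) =
       (\<Sum>a<n. if coprime a n then psum S j else 0)"
      unfolding * by (intro sum.cong) (auto simp: psum_coprime[OF n0 S I] mult.commute)
    also have "\<dots> = of_nat (card {a. a < n \<and> coprime a n}) * psum S j"
      by (simp add: sum.If_cases Int_def)
    also have "{a. a < n \<and> coprime a n} = totatives n"
      using n totatives_less by (auto simp: totatives_def intro!: Nat.gr0I)
    finally show ?thesis by (simp add: totient_def)
  qed
  ultimately have "real (totient n) * norm (psum S j) \<le> (n * real j / 2) * (\<Prod>p\<in>?T. 2 * (1 - 1 / real p))"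
    using neT by (simp add: norm_mult)
  also have "\<dots> = real (totient n) * (real j * 2 ^ card ?T / 2)"
    unfolding totient_formula2 prod.distrib prod_constant by (simp only: mult_ac times_divide_eq_right times_divide_eq_left)
  finally show ?thesis using n0 by simp
qed

text \<open>Induction on \<open>r\<close> through Newton's recursion, for arbitrary sequences so
  that \<open>C\<close> depends on \<open>r\<close> alone. Multiplying the error by \<open>K\<close>
  expresses a bound of order \<open>K ^ (r - 1)\<close> that also makes sense for
  \<open>r = 0\<close>.\<close>

lemma coefficient_estimate:
  "\<exists>C\<ge>0. \<forall>(d :: nat \<Rightarrow> complex) p K. K \<ge> 1 \<longrightarrow> norm (d 0) = 1 \<longrightarrow>
     (\<forall>j. of_nat (Suc j) * d (Suc j) = - (\<Sum>i\<le>j. d i * p (Suc j - i))) \<longrightarrow>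
     (\<forall>j>0. norm (p j) \<le> real j * K) \<longrightarrow>
     norm (d r - d 0 * (- p 1) ^ r / fact r) * K \<le> C * K ^ r"
proof (induction r rule: less_induct)
  case (less r)
  show ?case
  proof (cases r)
    case 0
    then show ?thesis by (intro exI[of _ 0]) auto
  next
    case (Suc m)
    define E where "E i C \<longleftrightarrow> (\<forall>(d :: nat \<Rightarrow> complex) p K. K \<ge> 1 \<longrightarrow> norm (d 0) = 1 \<longrightarrow>
     (\<forall>j. of_nat (Suc j) * d (Suc j) = - (\<Sum>i\<le>j. d i * p (Suc j - i))) \<longrightarrow>
     (\<forall>j>0. norm (p j) \<le> real j * K) \<longrightarrow>
     norm (d i - d 0 * (- p 1) ^ i / fact i) * K \<le> C * K ^ i)" for i C
    have "\<forall>i\<in>{..<r}. \<exists>C. C \<ge> 0 \<and> E i C"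
      unfolding E_def using less.IH by simp
    from bchoice[OF this] obtain C where C0: "\<And>i. i < r \<Longrightarrow> C i \<ge> 0" and C: "\<And>i. i < r \<Longrightarrow> E i (C i)"
      by auto
    \<comment> \<open>\<open>C m\<close> is the error inherited from \<open>d m * p 1\<close>. A
      term \<open>d i * p (Suc m - i)\<close> with \<open>i < m\<close> is at most
      \<open>(1 + C i) * K ^ i\<close> times \<open>Suc m * K\<close>, thus of order at most
      \<open>K ^ m\<close>, and goes into the error entirely.\<close>
    define B where "B = C m + (\<Sum>i<m. (1 + C i) * real (Suc m))"
    have B0: "B \<ge> 0"
      unfolding B_def using C0 Suc by (intro add_nonneg_nonneg sum_nonneg mult_nonneg_nonneg) (auto simp: less_Suc_eq)
    show ?thesis
    proof (intro exI[of _ B] conjI B0 allI impI)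
      fix d p :: "nat \<Rightarrow> complex" and K :: real
      assume K: "K \<ge> 1" and d0: "norm (d 0) = 1"
        and rec: "\<forall>j. of_nat (Suc j) * d (Suc j) = - (\<Sum>i\<le>j. d i * p (Suc j - i))"
        and p: "\<forall>j>0. norm (p j) \<le> real j * K"
      define e where "e i = d i - d 0 * (- p 1) ^ i / fact i" for i
      have e: "norm (e i) * K \<le> C i * K ^ i" if "i < r" for i
        using C[OF that] K d0 rec p unfolding E_def e_def by blast
      have p1: "norm (p 1) \<le> K" using p[rule_format, of 1] by simp
      have di: "norm (d i) \<le> (1 + C i) * K ^ i" if "i < r" for i
      proof -
        have "norm (d 0 * (- p 1) ^ i / fact i) = norm (p 1) ^ i / fact i"
          by (simp add: norm_mult norm_divide norm_power d0)
        also have "\<dots> \<le> K ^ i / 1"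
          using p1 K by (intro frac_le power_mono) auto
        finally have "norm (d 0 * (- p 1) ^ i / fact i) \<le> K ^ i" by simp
        moreover have "norm (e i) \<le> C i * K ^ i"
          using e[OF that] K mult_left_mono[of 1 K "norm (e i)"] by simp
        ultimately have "norm (d 0 * (- p 1) ^ i / fact i + e i) \<le> K ^ i + C i * K ^ i"
          by (intro order.trans[OF norm_triangle_ineq] add_mono)
        then show ?thesis by (simp add: e_def algebra_simps)
      qed
      define R where "R = (\<Sum>i<m. d i * p (Suc m - i))"
      have "of_nat (Suc m) * d (Suc m) = - (R + d m * p 1)"
        using rec[rule_format, of m] by (simp add: R_def lessThan_Suc_atMost[symmetric] del: of_nat_Suc)
      moreover have "of_nat (Suc m) * (d 0 * (- p 1) ^ Suc m / fact (Suc m)) = d 0 * (- p 1) ^ Suc m / fact m"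
        by (simp add: field_simps del: of_nat_Suc)
      moreover have "d m = d 0 * (- p 1) ^ m / fact m + e m" by (simp add: e_def)
      ultimately have "of_nat (Suc m) * e (Suc m) = - (R + e m * p 1)"
        unfolding e_def[of "Suc m"] right_diff_distrib by (simp add: algebra_simps)
      then have "real (Suc m) * norm (e (Suc m)) = norm (R + e m * p 1)"
        by (metis norm_minus_cancel norm_mult norm_of_nat)
      also have "\<dots> \<le> norm R + norm (e m) * norm (p 1)"
        by (metis norm_mult norm_triangle_ineq)
      finally have "real (Suc m) * norm (e (Suc m)) * K \<le> (norm R + norm (e m) * norm (p 1)) * K"
        using K by (intro mult_right_mono) auto
      also have "\<dots> = norm R * K + (norm (e m) * K) * norm (p 1)" by (simp add: algebra_simps)
      also have "(norm (e m) * K) * norm (p 1) \<le> (C m * K ^ m) * K"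
        using K C0[of m] Suc by (intro mult_mono e p1) auto
      also have "norm R * K \<le> (\<Sum>i<m. (1 + C i) * real (Suc m) * K ^ Suc m)"
      proof -
        have "norm R * K \<le> (\<Sum>i<m. norm (d i * p (Suc m - i))) * K"
          unfolding R_def using K by (intro mult_right_mono norm_sum) auto
        also have "\<dots> = (\<Sum>i<m. norm (d i) * norm (p (Suc m - i)) * K)"
          by (simp add: sum_distrib_right norm_mult)
        also have "\<dots> \<le> (\<Sum>i<m. ((1 + C i) * K ^ i) * (real (Suc m) * K) * K)"
        proof (intro sum_mono mult_right_mono mult_mono)
          fix i assume i: "i \<in> {..<m}"
          show "norm (d i) \<le> (1 + C i) * K ^ i" using i Suc by (intro di) auto
          have "norm (p (Suc m - i)) \<le> real (Suc m - i) * K" by (rule p[rule_format]) (use i in simp)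
          also have "\<dots> \<le> real (Suc m) * K" using K by (intro mult_right_mono) auto
          finally show "norm (p (Suc m - i)) \<le> real (Suc m) * K" .
          show "0 \<le> (1 + C i) * K ^ i" using C0[of i] i Suc K by auto
        qed (use K in auto)
        also have "\<dots> = (\<Sum>i<m. (1 + C i) * real (Suc m) * K ^ (i + 2))"
          by (simp add: power2_eq_square power_add mult_ac)
        also have "\<dots> \<le> (\<Sum>i<m. (1 + C i) * real (Suc m) * K ^ Suc m)"
        proof (intro sum_mono mult_left_mono power_increasing K)
          fix i assume i: "i \<in> {..<m}"
          then show "0 \<le> (1 + C i) * real (Suc m)" using C0[of i] Suc by auto
        qed auto
        finally show ?thesis .
      qed
      also have "(\<Sum>i<m. (1 + C i) * real (Suc m) * K ^ Suc m) + C m * K ^ m * K = B * K ^ Suc m"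
        by (simp add: B_def distrib_right sum_distrib_right mult.assoc mult.commute[of K])
      finally have "real (Suc m) * norm (e (Suc m)) * K \<le> B * K ^ Suc m" by simp
      moreover have "1 * (norm (e (Suc m)) * K) \<le> real (Suc m) * (norm (e (Suc m)) * K)"
        using K by (intro mult_right_mono) auto
      ultimately show "norm (d r - d 0 * (- p 1) ^ r / fact r) * K \<le> B * K ^ r"
        unfolding Suc e_def by (simp add: mult.assoc)
    qed
  qed
qed

text \<open>By the first Newton identity \<open>coeff d 1\<close> and \<open>psum S 1\<close> have
  the same absolute value. Stated through \<open>coeff d 1\<close>, the estimate serves both the
  upper bound for all divisors and the lower bound from one extremal divisor.\<close>

lemma coeff_divisor_estimate:
  "\<exists>C::real\<ge>0. \<forall>n>1::nat. \<forall>d::int poly. d dvd monom 1 n - 1 \<longrightarrow>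
     \<bar>\<bar>real_of_int (coeff d r)\<bar> - real_of_int \<bar>coeff d 1\<bar> ^ r / fact r\<bar> * (2 ^ card (prime_factors n) / 2)
       \<le> C * (2 ^ card (prime_factors n) / 2) ^ r \<and>
     real_of_int \<bar>coeff d 1\<bar> \<le> 2 ^ card (prime_factors n) / 2"
proof -
  obtain C where C0: "C \<ge> 0" and C: "\<forall>(d :: nat \<Rightarrow> complex) p K. K \<ge> 1 \<longrightarrow> norm (d 0) = 1 \<longrightarrow>
     (\<forall>j. of_nat (Suc j) * d (Suc j) = - (\<Sum>i\<le>j. d i * p (Suc j - i))) \<longrightarrow>
     (\<forall>j>0. norm (p j) \<le> real j * K) \<longrightarrow>
     norm (d r - d 0 * (- p 1) ^ r / fact r) * K \<le> C * K ^ r"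
    using coefficient_estimate[of r] by blast
  show ?thesis
  proof (intro exI[of _ C] conjI C0 allI impI)
    fix n :: nat and d :: "int poly"
    assume n: "n > 1" and dvd: "d dvd monom 1 n - 1"
    define K :: real where "K = 2 ^ card (prime_factors n) / 2"
    have "prime_factors n \<noteq> {}" using prime_factor_nat[of n] n by (auto simp: prime_factors_dvd)
    then have "card (prime_factors n) \<noteq> 0" by simp
    then obtain k where "card (prime_factors n) = Suc k" by (cases "card (prime_factors n)") auto
    then have K: "K \<ge> 1" by (simp add: K_def)
    obtain S where S: "S \<subseteq> {z. z ^ n = 1}"
      and dS: "cpoly d = smult (of_int (coeff d 0)) (\<Prod>s\<in>S. [:1, -s:])"
      using inverse_roots_of_divisor[OF _ dvd] n by auto
    have d0: "\<bar>coeff d 0\<bar> = 1" using coeff_0_divisor[OF _ dvd] n by simp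
    have finS: "finite S" using S finite_subset finite_roots_unity[of n] n by auto
    define D :: "nat \<Rightarrow> complex" where "D = (\<lambda>j. of_int (coeff d j))"
    have D0: "norm (D 0) = 1" using d0 by (simp add: D_def flip: of_int_abs)
    have rec: "\<forall>j. of_nat (Suc j) * D (Suc j) = - (\<Sum>i\<le>j. D i * psum S (Suc j - i))"
      using newton_identity[OF finS dS] by (simp add: D_def coeff_map_poly)
    have bd: "\<forall>j>0. norm (psum S j) \<le> real j * K"
      using norm_psum_le[OF n S psum_in_Ints[OF finS dS d0]] by (simp add: K_def)
    have main: "norm (D r - D 0 * (- psum S 1) ^ r / fact r) * K \<le> C * K ^ r"
      using C K D0 rec bd by blast
    have "D 1 = - D 0 * psum S 1" using rec[rule_format, of 0] by simp
    then have D1: "norm (D 1) = norm (psum S 1)" using D0 by (simp add: norm_mult)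
    then have "norm (D 0 * (- psum S 1) ^ r / fact r) = norm (D 1) ^ r / fact r"
      using D0 by (simp add: norm_mult norm_divide norm_power)
    then have "\<bar>norm (D r) - norm (D 1) ^ r / fact r\<bar> \<le> norm (D r - D 0 * (- psum S 1) ^ r / fact r)"
      by (metis norm_triangle_ineq3)
    then have "\<bar>norm (D r) - norm (D 1) ^ r / fact r\<bar> * K \<le> C * K ^ r"
      using main K by (meson mult_right_mono order.trans zero_le_one)
    then show "\<bar>\<bar>real_of_int (coeff d r)\<bar> - real_of_int \<bar>coeff d 1\<bar> ^ r / fact r\<bar> * (2 ^ card (prime_factors n) / 2)
       \<le> C * (2 ^ card (prime_factors n) / 2) ^ r"
      by (simp add: D_def K_def)
    show "real_of_int \<bar>coeff d 1\<bar> \<le> 2 ^ card (prime_factors n) / 2"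
      using D1 bd[rule_format, of 1] by (simp add: D_def K_def)
  qed
qed

section \<open>A divisor with extremal linear coefficient\<close>

text \<open>\<open>B\<close> has as many distinct complex roots as its degree, while the remainder
  of \<open>F\<close> has smaller degree and vanishes at all of them. For monic \<open>B\<close>,
  pseudo-division is ordinary division with integer quotient and remainder.\<close>

lemma monic_divisor_dvd:
  fixes B F :: "int poly"
  assumes n: "n > 0" and B: "B dvd monom 1 n - 1" "lead_coeff B = 1"
    and roots: "\<And>z. poly (cpoly B) z = 0 \<Longrightarrow> poly (cpoly F) z = 0"
  shows "B dvd F"
proof -
  have B0: "B \<noteq> 0" using B(2) by auto
  obtain q r where qr: "pseudo_divmod F B = (q, r)" by (cases "pseudo_divmod F B")
  have F: "F = B * q + r" using pseudo_divmod(1)[OF B0 qr] B(2) by simp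
  have "r = 0"
  proof (rule ccontr)
    assume r: "r \<noteq> 0"
    then have deg: "degree r < degree B" using pseudo_divmod(2)[OF B0 qr] by blast
    have cr: "cpoly r \<noteq> 0" using r by (simp add: map_poly_eq_0_iff)
    have cB: "cpoly B \<noteq> 0" using B0 by (simp add: map_poly_eq_0_iff)
    let ?Z = "{z. poly (cpoly B) z = 0}"
    have add: "cpoly (a + b) = cpoly a + cpoly b" for a b
      by (intro poly_eqI) (simp add: coeff_map_poly)
    have "?Z \<subseteq> {z. poly (cpoly r) z = 0}"
      using roots by (auto simp: F add cpoly_mult)
    then have "card ?Z \<le> card {z. poly (cpoly r) z = 0}"
      using poly_roots_finite[OF cr] by (intro card_mono) auto
    also have "\<dots> \<le> degree (cpoly r)" by (rule card_poly_roots_bound[OF cr])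
    also have "\<dots> < degree (cpoly B)" using deg by (simp add: degree_map_poly)
    also have "cpoly B = smult (lead_coeff (cpoly B)) (\<Prod>z\<in>?Z. [:-z, 1:])"
      using complex_poly_decompose_rsquarefree[OF rsquarefree_divisor[OF n B(1)]] by simp
    then have "degree (cpoly B) = degree (smult (lead_coeff (cpoly B)) (\<Prod>z\<in>?Z. [:-z, 1:]))"
      by (rule arg_cong)
    also have "\<dots> = card ?Z" using cB by (simp add: degree_prod_eq_sum_degree)
    finally show False by simp
  qed
  then show ?thesis using F by simp
qed

text \<open>
  Writing \<open>\<Phi>\<^sub>m\<close> for the cyclotomic polynomials, \<open>A\<close> and \<open>B\<close> are the products of the \<open>\<Phi>\<^sub>m\<close> over
  the divisors \<open>m\<close> of \<open>N\<close> with \<open>\<mu>(m) = 1\<close> and \<open>\<mu>(m) = -1\<close>, respectively. The identity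
  \<open>\<Phi>\<^sub>m\<^sub>p(x) \<Phi>\<^sub>m(x) = \<Phi>\<^sub>m(x\<^sup>p)\<close> turns \<open>(A, B)\<close> for \<open>N\<close> into \<open>(A(x) B(x\<^sup>p) / B(x), B(x) A(x\<^sup>p) / A(x))\<close>
  for \<open>N p\<close>. Closure of the roots under powers coprime to \<open>N\<close> makes the quotients integral.
\<close>
definition moebius_pair :: "nat \<Rightarrow> int poly \<Rightarrow> int poly \<Rightarrow> bool" where
  "moebius_pair N A B \<longleftrightarrow> A * B = monom 1 N - 1 \<and> lead_coeff A = 1 \<and> lead_coeff B = 1 \<and>
     (\<forall>q z. coprime q N \<longrightarrow> poly (cpoly A) z = 0 \<longrightarrow> poly (cpoly A) (z ^ q) = 0) \<and>
     (\<forall>q z. coprime q N \<longrightarrow> poly (cpoly B) z = 0 \<longrightarrow> poly (cpoly B) (z ^ q) = 0)"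

lemma moebius_pair_commute: "moebius_pair N A B \<Longrightarrow> moebius_pair N B A"
  by (auto simp: moebius_pair_def mult.commute)

lemma pcompose_x_pow: "p > 0 \<Longrightarrow> pcompose (monom 1 n - 1 :: int poly) (monom 1 p) = monom 1 (n * p) - 1"
  by (simp add: poly_eq_poly_eq_iff[symmetric] fun_eq_iff poly_pcompose poly_monom mult.commute flip: power_mult)

text \<open>The roots of \<open>B\<close> are closed under \<open>p\<close>-th powers, so
  \<open>B(x)\<close> divides \<open>B(x^p)\<close>. As \<open>p > 1\<close>, \<open>B(x^p)\<close>
  has no linear term; with \<open>C(0) = 1\<close> this gives
  \<open>coeff C 1 = - coeff B 1 / coeff B 0\<close>, and dividing by \<open>coeff B 0\<close>,
  which is 1 or -1, amounts to multiplying by it.\<close>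

lemma moebius_pair_quotient:
  assumes AB: "moebius_pair N A B" and N: "N > 0" and p: "prime p" "coprime p N"
  obtains C where "pcompose B (monom 1 p) = B * C" "lead_coeff C = 1"
    "\<And>q z. coprime q (N * p) \<Longrightarrow> poly (cpoly C) z = 0 \<Longrightarrow> poly (cpoly C) (z ^ q) = 0"
    "coeff C 0 = 1" "coeff C 1 = - coeff B 1 * coeff B 0"
proof -
  have p1: "p > 1" using p(1) by (rule prime_gt_1_nat)
  let ?Bp = "pcompose B (monom 1 p)"
  have prod: "A * B = monom 1 N - 1" and monic: "lead_coeff B = 1"
    and closed: "\<And>q z. coprime q N \<Longrightarrow> poly (cpoly B) z = 0 \<Longrightarrow> poly (cpoly B) (z ^ q) = 0"
    using AB unfolding moebius_pair_def by blast+
  have Bdvd: "B dvd monom 1 N - 1" by (metis prod dvd_triv_right)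
  have ev: "poly (cpoly ?Bp) z = poly (cpoly B) (z ^ p)" for z
    by (simp add: cpoly_pcompose map_poly_monom poly_pcompose poly_monom)
  have "B dvd ?Bp"
    by (rule monic_divisor_dvd[OF N Bdvd monic]) (use closed[OF p(2)] ev in auto)
  then obtain C where C: "?Bp = B * C" by blast
  have "pcompose A (monom 1 p) * ?Bp = monom 1 (N * p) - 1"
    using p1 by (simp flip: pcompose_mult add: prod pcompose_x_pow)
  then have Bpdvd: "?Bp dvd monom 1 (N * p) - 1" by (metis dvd_triv_right)
  have sqf: "rsquarefree (cpoly ?Bp)"
    by (rule rsquarefree_divisor[OF _ Bpdvd]) (use N p1 in simp)
  have rootC: "poly (cpoly C) z = 0 \<longleftrightarrow> poly (cpoly B) (z ^ p) = 0 \<and> poly (cpoly B) z \<noteq> 0" for z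
  proof -
    have "poly (cpoly B) z \<noteq> 0" if "poly (cpoly C) z = 0"
    proof
      assume "poly (cpoly B) z = 0"
      with that have "poly (cpoly ?Bp) z = 0 \<and> poly (pderiv (cpoly ?Bp)) z = 0"
        by (simp add: C cpoly_mult pderiv_mult)
      then show False using sqf unfolding rsquarefree_roots by blast
    qed
    moreover have "poly (cpoly B) (z ^ p) = poly (cpoly B) z * poly (cpoly C) z"
      by (simp flip: ev add: C cpoly_mult)
    ultimately show ?thesis by auto
  qed
  have closedC: "poly (cpoly C) (z ^ q) = 0" if q: "coprime q (N * p)" and z: "poly (cpoly C) z = 0" for q z
  proof -
    have qN: "coprime q N" using q by simp
    have zp: "poly (cpoly B) (z ^ p) = 0" and z0: "poly (cpoly B) z \<noteq> 0" using z rootC by auto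
    have "poly (cpoly B) ((z ^ p) ^ q) = 0" using closed[OF qN zp] .
    then have "poly (cpoly B) ((z ^ q) ^ p) = 0" by (simp flip: power_mult add: mult.commute)
    moreover have "poly (cpoly B) (z ^ q) \<noteq> 0"
    proof
      assume zq: "poly (cpoly B) (z ^ q) = 0"
      \<comment> \<open>Raising \<open>z ^ q\<close> to the inverse \<open>q'\<close> of
        \<open>q\<close> modulo \<open>N * p\<close> recovers \<open>z\<close>, which would then be
        a root of \<open>B\<close>.\<close>
      obtain q' where q': "[q * q' = Suc 0] (mod (N * p))"
        using cong_solve_coprime_nat[OF q] by blast
      have "coprime q' (N * p)"
        using q' by (metis coprime_iff_invertible_nat mult.commute)
      then have "coprime q' N" by simp
      from closed[OF this zq] have "poly (cpoly B) (z ^ (q * q')) = 0" by (simp add: power_mult)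
      moreover have "z ^ (N * p) = 1"
        using root_of_divisor[OF Bdvd zp] by (simp add: power_mult mult.commute flip: power_mult)
      then have "z ^ k = z ^ (k mod (N * p))" for k
        by (metis div_mult_mod_eq mult_1 power_add power_mult power_one mult.commute)
      then have "z ^ (q * q') = z ^ Suc 0" using q' unfolding cong_def by metis
      ultimately show False using z0 by simp
    qed
    ultimately show ?thesis using rootC by blast
  qed
  have "lead_coeff ?Bp = 1" using monic p1 by (subst lead_coeff_comp) (auto simp: degree_monom_eq)
  then have lcC: "lead_coeff C = 1" using C monic by (simp add: lead_coeff_mult)
  have b0: "\<bar>coeff B 0\<bar> = 1" by (rule coeff_0_divisor[OF N Bdvd])
  then have bb: "coeff B 0 * coeff B 0 = 1" by (metis abs_mult_self_eq mult_1)
  have "poly ?Bp 0 = poly B 0" using p1 by (simp add: poly_pcompose poly_monom power_0_left)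
  then have "coeff B 0 * coeff C 0 = coeff B 0" by (simp add: C poly_0_coeff_0 coeff_mult)
  then have c0: "coeff C 0 = 1" using b0 by auto
  have "poly (pderiv ?Bp) 0 = 0"
    using p1 by (simp add: pderiv_pcompose pderiv_monom poly_monom power_0_left)
  then have "coeff ?Bp 1 = 0" by (simp add: poly_0_coeff_0 coeff_pderiv)
  then have "coeff B 1 * coeff C 0 + coeff B 0 * coeff C 1 = 0"
    unfolding C by (simp add: coeff_mult algebra_simps)
  then have "coeff B 0 * coeff C 1 = - coeff B 1" using c0 by simp
  then have "coeff B 0 * coeff B 0 * coeff C 1 = - coeff B 1 * coeff B 0" by (simp add: mult_ac)
  then have "coeff C 1 = - coeff B 1 * coeff B 0" using bb by simp
  then show ?thesis using that C lcC closedC c0 by blast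
qed

text \<open>With \<open>u = coeff A 0 * coeff A 1\<close> and
  \<open>v = coeff B 0 * coeff B 1\<close>, adjoining a prime maps \<open>(u, v)\<close> to
  \<open>(u - v, v - u)\<close>: the difference doubles and the sum vanishes. The start
  \<open>A = x - 1\<close>, \<open>B = 1\<close> has \<open>(u, v) = (-1, 0)\<close>. The constant
  coefficients in \<open>u\<close> and \<open>v\<close> absorb the signs of \<open>A\<close> and
  \<open>B\<close>.\<close>

lemma moebius_pair_exists:
  assumes "finite T" "\<And>p. p \<in> T \<Longrightarrow> prime p"
  shows "\<exists>A B. moebius_pair (\<Prod>T) A B \<and>
     coeff A 0 * coeff A 1 - coeff B 0 * coeff B 1 = - (2 ^ card T) \<and>
     (T \<noteq> {} \<longrightarrow> coeff A 0 * coeff A 1 + coeff B 0 * coeff B 1 = 0)"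
  using assms
proof (induction T rule: finite_induct)
  case empty
  have "monom 1 1 - 1 = [:-1, 1 :: int:]" by (simp add: monom_altdef one_pCons)
  then have "moebius_pair (\<Prod>{}) [:-1, 1:] 1"
    by (auto simp: moebius_pair_def map_poly_pCons)
  then show ?case by (intro exI[of _ "[:-1, 1:]"] exI[of _ 1]) simp
next
  case (insert p T)
  let ?N = "\<Prod>T"
  obtain A B where AB: "moebius_pair ?N A B"
    and diff: "coeff A 0 * coeff A 1 - coeff B 0 * coeff B 1 = - (2 ^ card T)"
    using insert by blast
  have N: "?N > 0" using insert.prems by (intro prod_pos) (auto simp: prime_gt_0_nat)
  have p: "prime p" using insert.prems by blast
  have cop: "coprime p ?N"
  proof (rule prod_coprime_right)
    fix q assume "q \<in> T"
    then show "coprime p q" using insert p by (intro primes_coprime) auto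
  qed
  obtain C where C: "pcompose B (monom 1 p) = B * C" "lead_coeff C = 1"
    "\<And>q z. coprime q (?N * p) \<Longrightarrow> poly (cpoly C) z = 0 \<Longrightarrow> poly (cpoly C) (z ^ q) = 0"
    "coeff C 0 = 1" "coeff C 1 = - coeff B 1 * coeff B 0"
    using moebius_pair_quotient[OF AB N p cop] by blast
  obtain E where E: "pcompose A (monom 1 p) = A * E" "lead_coeff E = 1"
    "\<And>q z. coprime q (?N * p) \<Longrightarrow> poly (cpoly E) z = 0 \<Longrightarrow> poly (cpoly E) (z ^ q) = 0"
    "coeff E 0 = 1" "coeff E 1 = - coeff A 1 * coeff A 0"
    using moebius_pair_quotient[OF moebius_pair_commute[OF AB] N p cop] by blast
  have AB': "A * B = monom 1 ?N - 1" "lead_coeff A = 1" "lead_coeff B = 1"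
    "\<And>q z. coprime q ?N \<Longrightarrow> poly (cpoly A) z = 0 \<Longrightarrow> poly (cpoly A) (z ^ q) = 0"
    "\<And>q z. coprime q ?N \<Longrightarrow> poly (cpoly B) z = 0 \<Longrightarrow> poly (cpoly B) (z ^ q) = 0"
    using AB unfolding moebius_pair_def by blast+
  have Np: "\<Prod>(insert p T) = ?N * p" using insert.hyps by simp
  have "(A * C) * (B * E) = (A * E) * (B * C)" by (simp only: mult_ac)
  also have "\<dots> = monom 1 (?N * p) - 1"
    using prime_gt_0_nat[OF p] by (simp flip: C(1) E(1) pcompose_mult add: AB'(1) pcompose_x_pow)
  finally have "moebius_pair (?N * p) (A * C) (B * E)"
    unfolding moebius_pair_def using AB'(2-) C(2,3) E(2,3)
    by (auto simp: lead_coeff_mult cpoly_mult)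
  moreover have a0: "coeff A 0 * coeff A 0 = 1" and b0: "coeff B 0 * coeff B 0 = 1"
  proof -
    have "\<bar>coeff A 0\<bar> = 1" "\<bar>coeff B 0\<bar> = 1"
      by (rule coeff_0_divisor[OF N]; metis AB'(1) dvd_triv_left dvd_triv_right)+
    then show "coeff A 0 * coeff A 0 = 1" "coeff B 0 * coeff B 0 = 1"
      by (metis abs_mult_self_eq mult_1)+
  qed
  have mult1: "coeff (X * Y) 0 * coeff (X * Y) 1 =
     coeff X 0 * coeff X 1 + coeff X 0 * coeff X 0 * coeff Y 1" if "coeff Y 0 = 1" for X Y :: "int poly"
    using that by (simp add: coeff_mult algebra_simps)
  have "coeff (A * C) 0 * coeff (A * C) 1 = coeff A 0 * coeff A 1 - coeff B 0 * coeff B 1"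
    unfolding mult1[OF C(4)] a0 C(5) by simp
  moreover have "coeff (B * E) 0 * coeff (B * E) 1 = coeff B 0 * coeff B 1 - coeff A 0 * coeff A 1"
    unfolding mult1[OF E(4)] b0 E(5) by simp
  ultimately show ?case
    unfolding Np using diff insert.hyps by (intro exI[of _ "A * C"] exI[of _ "B * E"]) simp
qed

lemma divisor_extremal_linear_coeff:
  assumes "n > 1"
  obtains d :: "int poly" where "d dvd monom 1 n - 1"
    "real_of_int \<bar>coeff d 1\<bar> = 2 ^ card (prime_factors n) / 2"
proof -
  let ?T = "prime_factors n" and ?N = "\<Prod>(prime_factors n)"
  have T: "finite ?T" "\<And>p. p \<in> ?T \<Longrightarrow> prime p" by auto
  have ne: "?T \<noteq> {}" using prime_factor_nat[of n] assms by (auto simp: prime_factors_dvd)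
  obtain A B where AB: "moebius_pair ?N A B"
    and diff: "coeff A 0 * coeff A 1 - coeff B 0 * coeff B 1 = - (2 ^ card ?T)"
    and sum: "coeff A 0 * coeff A 1 + coeff B 0 * coeff B 1 = 0"
    using moebius_pair_exists[OF T] ne by blast
  have N: "?N > 0" by (intro prod_pos) (auto intro: prime_gt_0_nat)
  have "A dvd monom 1 ?N - 1" using AB by (metis moebius_pair_def dvd_triv_left)
  moreover have "?N dvd n"
  proof -
    have "?N dvd (\<Prod>p\<in>?T. p ^ multiplicity p n)"
      by (intro prod_dvd_prod dvd_power) (auto simp: prime_factors_multiplicity)
    then show ?thesis using prime_factorization_nat[of n] assms by simp
  qed
  then obtain k where k: "n = ?N * k" by blast
  have "(monom 1 ?N :: int poly) - 1 dvd monom 1 n - 1"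
  proof -
    have "(monom 1 n :: int poly) = monom 1 ?N ^ k" by (subst k) (simp add: monom_power)
    then show ?thesis by (simp add: power_diff_1_eq)
  qed
  ultimately have dvd: "A dvd monom 1 n - 1" by (rule dvd_trans)
  have "\<bar>coeff A 0\<bar> = 1" using coeff_0_divisor[OF _ dvd] assms by simp
  then have "2 * \<bar>coeff A 1\<bar> = \<bar>2 * (coeff A 0 * coeff A 1)\<bar>" by (simp add: abs_mult)
  also have "2 * (coeff A 0 * coeff A 1) = - (2 ^ card ?T)" using diff sum by linarith
  finally have "2 * \<bar>coeff A 1\<bar> = 2 ^ card ?T" by simp
  then have "2 * real_of_int \<bar>coeff A 1\<bar> = 2 ^ card ?T" by (metis of_int_mult of_int_numeral of_int_power)
  then show ?thesis using that[OF dvd] by simp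
qed

section \<open>Sums of multiplicative functions\<close>

text \<open>A multiplicative function encoded by its values at prime powers. Letting
  \<open>g\<close> depend on \<open>p\<close> admits weights such as \<open>f i / p ^ i\<close>,
  which turn divisor sums into Euler products.\<close>

definition prime_power_prod :: "(nat \<Rightarrow> nat \<Rightarrow> 'a :: comm_semiring_1) \<Rightarrow> nat \<Rightarrow> 'a" where
  "prime_power_prod g n = (\<Prod>p\<in>prime_factors n. g p (multiplicity p n))"

lemma prime_power_prod_1 [simp]: "prime_power_prod g (Suc 0) = 1"
  by (simp add: prime_power_prod_def)

lemma prime_power_prod_prime_power_mult:
  assumes "prime p" "\<not> p dvd m" "g p 0 = 1"
  shows "prime_power_prod g (p ^ i * m) = g p i * prime_power_prod g m"
proof (cases "i = 0")
  case False
  have m: "m > 0" using assms(2) by (intro Nat.gr0I) auto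
  have pf: "prime_factors (p ^ i * m) = insert p (prime_factors m)"
    using assms(1) m False
    by (auto simp: prime_factors_dvd prime_dvd_mult_iff prime_dvd_power_iff prime_gt_0_nat
        dest: primes_dvd_imp_eq)
  have "multiplicity p (p ^ i * m) = i"
    using assms m by (simp add: prime_elem_multiplicity_mult_distrib not_dvd_imp_multiplicity_0)
  moreover have "multiplicity q (p ^ i * m) = multiplicity q m" if "q \<in> prime_factors m" for q
  proof -
    have q: "prime q" "q \<noteq> p" using that assms(2) by auto
    then have "multiplicity q (p ^ i) = 0"
      using assms(1) by (metis multiplicity_distinct_prime_power)
    then show ?thesis
      using q(1) assms(1) m by (simp add: prime_elem_multiplicity_mult_distrib)
  qed
  moreover have "p \<notin> prime_factors m" using assms(2) by auto
  ultimately show ?thesis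
    unfolding prime_power_prod_def pf by (simp cong: prod.cong)
qed (simp add: assms(3))

lemma bij_betw_divisors_prime_power_mult:
  fixes p m :: nat
  assumes p: "prime p" "\<not> p dvd m"
  shows "bij_betw (\<lambda>(i, d). p ^ i * d) ({..a} \<times> {d. d dvd m}) {d. d dvd p ^ a * m}"
  unfolding bij_betw_def
proof
  have m: "m > 0" using p(2) by (intro Nat.gr0I) auto
  show "inj_on (\<lambda>(i, d). p ^ i * d) ({..a} \<times> {d. d dvd m})"
  proof (rule inj_onI, clarify)
    fix i d j e assume d: "d dvd m" and e: "e dvd m" and eq: "p ^ i * d = p ^ j * e"
    have "multiplicity p (p ^ i * d) = i" if "d dvd m" for i d
    proof -
      have "\<not> p dvd d" "d \<noteq> 0" using that p m by (auto dest: dvd_trans)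
      then show ?thesis
        using p(1) by (simp add: prime_elem_multiplicity_mult_distrib not_dvd_imp_multiplicity_0)
    qed
    with d e eq have "i = j" by metis
    then show "i = j \<and> d = e" using eq p(1) by (simp add: prime_gt_0_nat)
  qed
  show "(\<lambda>(i, d). p ^ i * d) ` ({..a} \<times> {d. d dvd m}) = {d. d dvd p ^ a * m}"
  proof (intro equalityI subsetI)
    fix d assume "d \<in> {d. d dvd p ^ a * m}"
    then obtain b e where d: "d = b * e" "b dvd p ^ a" "e dvd m"
      using division_decomp[of d "p ^ a" m] by auto
    obtain i where "i \<le> a" "b = p ^ i"
      using d(2) p(1) divides_primepow_nat by blast
    then show "d \<in> (\<lambda>(i, d). p ^ i * d) ` ({..a} \<times> {d. d dvd m})"
      using d by force
  qed (auto intro!: mult_dvd_mono le_imp_power_dvd)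
qed

text \<open>Convolution with the constant 1 acts on local data as partial summation, that is, it
  divides each local generating series by \<open>1 - x\<close>. The induction splits off one full
  prime power at a time.\<close>

lemma sum_divisors_prime_power_prod:
  fixes g :: "nat \<Rightarrow> nat \<Rightarrow> 'a :: comm_semiring_1"
  assumes g: "\<And>p. g p 0 = 1" and n: "n > 0"
  shows "(\<Sum>d | d dvd n. prime_power_prod g d) = prime_power_prod (\<lambda>p a. \<Sum>i\<le>a. g p i) n"
  using n
proof (induction n rule: less_induct)
  case (less n)
  show ?case
  proof (cases "n = 1")
    case False
    then obtain p where p: "prime p" "p dvd n" using prime_factor_nat by blast
    obtain m where m: "n = p ^ multiplicity p n * m" "\<not> p dvd m"
      using multiplicity_decompose'[of n p] less.prems p(1) by (metis not_prime_unit neq0_conv)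
    define a where "a = multiplicity p n"
    have "a > 0" using p less.prems by (simp add: a_def prime_multiplicity_gt_zero_iff)
    have m0: "m > 0" using m(2) by (intro Nat.gr0I) auto
    have na: "n = p ^ a * m" using m(1) by (simp add: a_def)
    have "1 < p ^ a" using \<open>a > 0\<close> prime_gt_1_nat[OF p(1)] by (metis one_less_power)
    then have "m < n" using m0 unfolding na by simp
    have "(\<Sum>d | d dvd n. prime_power_prod g d) =
       (\<Sum>(i, d)\<in>{..a} \<times> {d. d dvd m}. prime_power_prod g (p ^ i * d))"
      unfolding na
      by (subst sum.reindex_bij_betw[OF bij_betw_divisors_prime_power_mult[OF p(1) m(2)], symmetric])
         (simp add: case_prod_unfold)
    also have "\<dots> = (\<Sum>(i, d)\<in>{..a} \<times> {d. d dvd m}. g p i * prime_power_prod g d)"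
    proof (intro sum.cong refl, clarify)
      fix i d assume "d dvd m"
      then have "\<not> p dvd d" using m(2) dvd_trans by blast
      then show "prime_power_prod g (p ^ i * d) = g p i * prime_power_prod g d"
        by (intro prime_power_prod_prime_power_mult p(1) g)
    qed
    also have "\<dots> = (\<Sum>i\<le>a. g p i) * (\<Sum>d | d dvd m. prime_power_prod g d)"
      by (simp add: sum_product sum.cartesian_product)
    also have "\<dots> = (\<Sum>i\<le>a. g p i) * prime_power_prod (\<lambda>p a. \<Sum>i\<le>a. g p i) m"
      using less.IH[OF \<open>m < n\<close> m0] by simp
    also have "\<dots> = prime_power_prod (\<lambda>p a. \<Sum>i\<le>a. g p i) n"
      unfolding na by (rule prime_power_prod_prime_power_mult[symmetric]) (simp_all add: p m g)
    finally show ?thesis .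
  qed simp
qed

section \<open>Summatory functions of Dirichlet convolutions with 1\<close>

definition upto_sum :: "(nat \<Rightarrow> real) \<Rightarrow> real \<Rightarrow> real" where
  "upto_sum F x = (\<Sum>n | 1 \<le> n \<and> real n \<le> x. F n)"

lemma finite_upto: "finite {n. 1 \<le> n \<and> real n \<le> x}"
proof (rule finite_subset)
  show "{n. 1 \<le> n \<and> real n \<le> x} \<subseteq> {..nat \<lfloor>x\<rfloor>}" by (auto simp: le_nat_floor)
qed simp

lemma card_upto: "x \<ge> 0 \<Longrightarrow> real (card {n. 1 \<le> n \<and> real n \<le> x}) = of_int \<lfloor>x\<rfloor>"
proof -
  assume x: "x \<ge> 0"
  have "{n. 1 \<le> n \<and> real n \<le> x} = {1..nat \<lfloor>x\<rfloor>}"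
    using x by (auto simp: le_nat_iff le_floor_iff)
  then show ?thesis using x by simp
qed

text \<open>Writing \<open>n = m * d\<close> and ordering by the cofactor \<open>m\<close> suits an
  \<open>F\<close> whose summatory function is already known asymptotically. Ordering by
  \<open>d\<close> suits an \<open>F\<close> with \<open>F d / d\<close> absolutely
  summable.\<close>

lemma upto_sum_divisors:
  "upto_sum (\<lambda>n. \<Sum>d | d dvd n. F d) x = (\<Sum>m | 1 \<le> m \<and> real m \<le> x. upto_sum F (x / real m))"
proof -
  have "upto_sum (\<lambda>n. \<Sum>d | d dvd n. F d) x =
     (\<Sum>(n, d)\<in>Sigma {n. 1 \<le> n \<and> real n \<le> x} (\<lambda>n. {d. d dvd n}). F d)"
    unfolding upto_sum_def by (rule sum.Sigma) (auto simp: finite_upto[simplified])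
  also have "\<dots> = (\<Sum>(m, d)\<in>Sigma {m. 1 \<le> m \<and> real m \<le> x} (\<lambda>m. {d. 1 \<le> d \<and> real d \<le> x / real m}). F d)"
  proof (rule sum.reindex_bij_witness[where i = "\<lambda>(m, d). (m * d, d)" and j = "\<lambda>(n, d). (n div d, d)"], goal_cases)
    case (2 b)
    then obtain n d where b: "b = (n, d)" "1 \<le> n" "real n \<le> x" "d dvd n" by auto
    then obtain m where m: "n = d * m" by blast
    with b have "d > 0" "m > 0" by auto
    have "real m \<le> real (d * m)" using \<open>d > 0\<close> by (subst of_nat_le_iff) simp
    with b m have "real m \<le> x" by linarith
    then show ?case using b m \<open>d > 0\<close> \<open>m > 0\<close> by (auto simp: field_simps)
  next
    case (4 b)
    then obtain m d where "b = (m, d)" "1 \<le> m" "1 \<le> d" "real d \<le> x / real m" by auto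
    then show ?case by (auto simp: field_simps)
  qed (auto)
  also have "\<dots> = (\<Sum>m | 1 \<le> m \<and> real m \<le> x. upto_sum F (x / real m))"
    unfolding upto_sum_def by (rule sum.Sigma[symmetric]) (auto simp: finite_upto[simplified])
  finally show ?thesis .
qed

lemma upto_sum_divisors_floor:
  "upto_sum (\<lambda>n. \<Sum>d | d dvd n. F d) x = (\<Sum>d | 1 \<le> d \<and> real d \<le> x. F d * of_int \<lfloor>x / real d\<rfloor>)"
proof -
  let ?N = "{n. 1 \<le> n \<and> real n \<le> x}"
  have le: "real d \<le> x" if "1 \<le> m" "real d \<le> x / real m" for d m :: nat
  proof -
    have "real d \<le> real d * real m" using that(1) mult_left_mono[of 1 "real m" "real d"] by simp
    also have "\<dots> \<le> x" using that by (simp add: field_simps)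
    finally show ?thesis .
  qed
  have "upto_sum (\<lambda>n. \<Sum>d | d dvd n. F d) x = (\<Sum>m\<in>?N. \<Sum>d\<in>{d\<in>?N. real d \<le> x / real m}. F d)"
    unfolding upto_sum_divisors upto_sum_def by (intro sum.cong) (use le in auto)
  also have "\<dots> = (\<Sum>d\<in>?N. \<Sum>m\<in>{m\<in>?N. real d \<le> x / real m}. F d)"
    by (intro sum.swap_restrict finite_upto)
  also have "\<dots> = (\<Sum>d\<in>?N. F d * of_int \<lfloor>x / real d\<rfloor>)"
  proof (intro sum.cong refl)
    fix d assume d: "d \<in> ?N"
    then have x: "x \<ge> 0" by auto
    have "{m\<in>?N. real d \<le> x / real m} = {m. 1 \<le> m \<and> real m \<le> x / real d}"
      using d le by (auto simp: field_simps)
    then show "(\<Sum>m\<in>{m\<in>?N. real d \<le> x / real m}. F d) = F d * of_int \<lfloor>x / real d\<rfloor>"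
      using card_upto[of "x / real d"] x d by (simp add: mult.commute)
  qed
  finally show ?thesis .
qed

text \<open>Each term tends to \<open>F d / d\<close> and is dominated by
  \<open>\<bar>F d\<bar> / d\<close>, so Tannery's theorem interchanges limit and series.\<close>

lemma upto_sum_divisors_tendsto:
  assumes "summable (\<lambda>d. \<bar>F d\<bar> / real d)"
  shows "((\<lambda>x. upto_sum (\<lambda>n. \<Sum>d | d dvd n. F d) x / x) \<longlongrightarrow> (\<Sum>d. F d / real d)) at_top"
proof -
  define a where "a d x = F d * of_int \<lfloor>x / real d\<rfloor> / x" for d :: nat and x :: real
  have lim: "((\<lambda>x. a d x) \<longlongrightarrow> F d / real d) at_top" for d
  proof (cases "d = 0")
    case False
    have "((\<lambda>x. of_int \<lfloor>x / real d\<rfloor> / x) \<longlongrightarrow> 1 / real d) at_top"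
    proof (rule tendsto_sandwich)
      show "eventually (\<lambda>x. 1 / real d - 1 / x \<le> of_int \<lfloor>x / real d\<rfloor> / x) at_top"
        using eventually_gt_at_top[of 0]
      proof eventually_elim
        case (elim x)
        have "x / real d - 1 \<le> of_int \<lfloor>x / real d\<rfloor>" by linarith
        then have "(x / real d - 1) / x \<le> of_int \<lfloor>x / real d\<rfloor> / x"
          using elim by (intro divide_right_mono) auto
        then show ?case using elim by (simp add: diff_divide_distrib)
      qed
      show "eventually (\<lambda>x. of_int \<lfloor>x / real d\<rfloor> / x \<le> 1 / real d) at_top"
        using eventually_gt_at_top[of 0]
      proof eventually_elim
        case (elim x)
        have "of_int \<lfloor>x / real d\<rfloor> / x \<le> (x / real d) / x"
          using elim by (intro divide_right_mono) auto
        then show ?case using elim by simp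
      qed
      show "((\<lambda>x. 1 / real d - 1 / x) \<longlongrightarrow> 1 / real d) at_top"
        by (rule tendsto_eq_rhs[OF tendsto_diff[OF tendsto_const tendsto_divide_0[OF tendsto_const filterlim_at_top_imp_at_infinity[OF filterlim_ident]]]]) simp
    qed simp
    then have "((\<lambda>x. F d * (of_int \<lfloor>x / real d\<rfloor> / x)) \<longlongrightarrow> F d * (1 / real d)) at_top"
      by (intro tendsto_mult tendsto_const)
    then show ?thesis by (simp add: a_def)
  qed (simp add: a_def)
  have bound: "eventually (\<lambda>(d, x). norm (a d x) \<le> \<bar>F d\<bar> / real d) (at_top \<times>\<^sub>F at_top)"
  proof -
    have "norm (a d x) \<le> \<bar>F d\<bar> / real d" if "x > 0" for d x
    proof -
      have "\<bar>of_int \<lfloor>x / real d\<rfloor>\<bar> \<le> x / real d"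
        using that by (simp add: abs_of_nonneg)
      then have "\<bar>F d\<bar> * \<bar>of_int \<lfloor>x / real d\<rfloor>\<bar> / x \<le> \<bar>F d\<bar> * (x / real d) / x"
        using that by (intro divide_right_mono mult_left_mono) auto
      then show ?thesis using that by (simp add: a_def abs_mult)
    qed
    then have "eventually (\<lambda>z. norm (a (fst z) (snd z)) \<le> \<bar>F (fst z)\<bar> / real (fst z)) (at_top \<times>\<^sub>F at_top)"
      by (intro eventually_mono[OF eventually_prodI[OF eventually_True eventually_gt_at_top[of 0]]]) auto
    then show ?thesis by (simp add: case_prod_unfold)
  qed
  have "((\<lambda>x. \<Sum>d. a d x) \<longlongrightarrow> (\<Sum>d. F d / real d)) at_top"
    using tannerys_theorem[OF lim bound assms] by simp
  moreover have "eventually (\<lambda>x. (\<Sum>d. a d x) = upto_sum (\<lambda>n. \<Sum>d | d dvd n. F d) x / x) at_top"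
    using eventually_gt_at_top[of 0]
  proof eventually_elim
    case (elim x)
    \<comment> \<open>The series is a finite sum because the floor vanishes for
      \<open>d > x\<close>; at \<open>d = 0\<close> division by zero yields 0.\<close>
    have "(\<Sum>d. a d x) = (\<Sum>d | 1 \<le> d \<and> real d \<le> x. a d x)"
    proof (intro suminf_finite finite_upto)
      fix d assume "d \<notin> {d. 1 \<le> d \<and> real d \<le> x}"
      then have "d = 0 \<or> real d > x" by auto
      then have "\<lfloor>x / real d\<rfloor> = 0" using elim by (auto simp: floor_eq_iff)
      then show "a d x = 0" by (simp add: a_def)
    qed
    then show ?case by (simp add: upto_sum_divisors_floor a_def sum_divide_distrib)
  qed
  ultimately show ?thesis by (rule Lim_transform_eventually)
qed

text \<open>Mean value theorem between \<open>m\<close> and \<open>Suc m\<close> for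
  \<open>- ln (x / t) ^ Suc i / Suc i\<close>, whose derivative \<open>ln (x / t) ^ i / t\<close>
  decreases for \<open>0 < t \<le> x\<close>; this compares the sum of the derivative with a
  telescoping sum.\<close>

lemma log_power_step:
  fixes x :: real and m :: nat
  assumes m: "1 \<le> m" "real (Suc m) \<le> x"
  shows "ln (x / Suc m) ^ i / Suc m \<le> (ln (x / m) ^ Suc i - ln (x / Suc m) ^ Suc i) / Suc i"
    and "(ln (x / m) ^ Suc i - ln (x / Suc m) ^ Suc i) / Suc i \<le> ln (x / m) ^ i / m"
proof -
  have x: "x > 0" using m by linarith
  define G where "G t = - (ln (x / t) ^ Suc i / Suc i)" for t
  have der: "(G has_real_derivative (ln (x / t) ^ i / t)) (at t)" if "t > 0" for t
    unfolding G_def using that x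
    by (auto intro!: derivative_eq_intros simp: field_simps simp del: power_Suc of_nat_Suc)
  obtain z where z: "real m < z" "z < real (Suc m)"
    "G (real (Suc m)) - G (real m) = (real (Suc m) - real m) * (ln (x / z) ^ i / z)"
    using MVT2[of "real m" "real (Suc m)" G "\<lambda>t. ln (x / t) ^ i / t"] der m by auto
  then have eq: "(ln (x / m) ^ Suc i - ln (x / Suc m) ^ Suc i) / Suc i = ln (x / z) ^ i / z"
    by (simp add: G_def diff_divide_distrib del: power_Suc of_nat_Suc)
  have mono: "ln (x / t) ^ i / t \<le> ln (x / s) ^ i / s" if "0 < s" "s \<le> t" "t \<le> x" for s t
  proof (intro frac_le power_mono)
    show "0 \<le> ln (x / s) ^ i" "0 \<le> ln (x / t)" using that by (auto intro!: zero_le_power ln_ge_zero simp: field_simps)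
    show "ln (x / t) \<le> ln (x / s)" using that by (simp add: frac_le x)
  qed (use that in auto)
  show "ln (x / Suc m) ^ i / Suc m \<le> (ln (x / m) ^ Suc i - ln (x / Suc m) ^ Suc i) / Suc i"
    unfolding eq using z m by (intro mono) auto
  show "(ln (x / m) ^ Suc i - ln (x / Suc m) ^ Suc i) / Suc i \<le> ln (x / m) ^ i / m"
    unfolding eq using z m by (intro mono) auto
qed

text \<open>After telescoping two errors remain: the term at \<open>m = 1\<close>, which is
  \<open>ln x ^ i\<close>, and the end value \<open>L M\<close>, which is at most 1 because
  \<open>x / M \<le> 2\<close>.\<close>

lemma log_power_sum_bounds:
  fixes x :: real
  assumes x: "x \<ge> 1"
  shows "\<bar>(\<Sum>m | 1 \<le> m \<and> real m \<le> x. ln (x / m) ^ i / m) - ln x ^ Suc i / Suc i\<bar> \<le> ln x ^ i + 1"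
proof -
  define g where "g m = ln (x / real m) ^ i / real m" for m :: nat
  define L where "L m = ln (x / real m) ^ Suc i / Suc i" for m :: nat
  define M where "M = nat \<lfloor>x\<rfloor>"
  have M: "M \<ge> 1" "real M \<le> x" "x < real M + 1" using x unfolding M_def by linarith+
  have "{m. 1 \<le> m \<and> real m \<le> x} = {1..M}"
    using x by (auto simp: M_def le_nat_iff le_floor_iff)
  moreover have "sum g {1..N} \<le> g 1 + (L 1 - L N) \<and> (L 1 - L N) \<le> sum g {1..N}"
    if "N \<ge> 1" "N \<le> M" for N
    using that
  proof (induction N rule: nat_induct_at_least)
    case base
    have "g 1 \<ge> 0" using x by (simp add: g_def)
    then show ?case by simp
  next
    case (Suc N)
    have "real (Suc N) \<le> x" using Suc.prems M(2) by linarith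
    from log_power_step[OF Suc.hyps this, of i]
    have 1: "g (Suc N) \<le> L N - L (Suc N)" "L N - L (Suc N) \<le> g N"
      by (simp_all add: g_def L_def diff_divide_distrib del: power_Suc of_nat_Suc)
    have *: "L 1 - L N' \<le> sum g {1..<N'}" if "N' \<ge> 1" "N' \<le> Suc N" for N'
      using that
    proof (induction N' rule: nat_induct_at_least)
      case (Suc k)
      have "real (Suc k) \<le> x" using Suc.prems \<open>real (Suc N) \<le> x\<close> by linarith
      from log_power_step(2)[OF Suc.hyps this, of i]
      have "L k - L (Suc k) \<le> g k"
        by (simp add: g_def L_def diff_divide_distrib del: power_Suc of_nat_Suc)
      then show ?case using Suc by simp
    qed simp
    have "g (Suc N) \<ge> 0"
      unfolding g_def using \<open>real (Suc N) \<le> x\<close> by (intro divide_nonneg_nonneg zero_le_power ln_ge_zero) (auto simp: field_simps)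
    then show ?case using Suc 1 *[of "Suc N"] by (simp add: atLeastLessThanSuc_atLeastAtMost)
  qed
  from this[of M] have "sum g {1..M} \<le> g 1 + (L 1 - L M)" "L 1 - L M \<le> sum g {1..M}" using M by auto
  moreover have "0 \<le> L M" "L M \<le> 1"
  proof -
    have le: "0 \<le> ln (x / M)" using M by (intro ln_ge_zero) (auto simp: field_simps)
    then show "0 \<le> L M" unfolding L_def by (intro divide_nonneg_nonneg zero_le_power) auto
    have "x / M \<le> 2" using M by (simp add: field_simps)
    then have "ln (x / M) \<le> x / M - 1" using M by (intro ln_le_minus_one) auto
    then have "ln (x / M) \<le> 1" using \<open>x / M \<le> 2\<close> by linarith
    then have "ln (x / M) ^ Suc i \<le> 1" using le by (intro power_le_one) auto
    then show "L M \<le> 1" unfolding L_def by (simp add: field_simps del: power_Suc)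
  qed
  moreover have "g 1 = ln x ^ i" "L 1 = ln x ^ Suc i / Suc i" by (simp_all add: g_def L_def)
  moreover have "ln x ^ i \<ge> 0" using x by simp
  ultimately show ?thesis unfolding g_def[symmetric] by (simp add: abs_le_iff del: power_Suc of_nat_Suc)
qed

lemma tendsto_const_div_ln_power: "((\<lambda>x::real. k / ln x ^ Suc i) \<longlongrightarrow> 0) at_top"
proof -
  have "filterlim (\<lambda>x::real. ln x ^ Suc i) at_top at_top"
    by (intro filterlim_pow_at_top ln_at_top) simp
  then show ?thesis
    by (intro tendsto_divide_0[OF tendsto_const] filterlim_at_top_imp_at_infinity)
qed

lemma log_power_sum_tendsto:
  "((\<lambda>x. (\<Sum>m | 1 \<le> m \<and> real m \<le> x. ln (x / m) ^ i / m) / ln x ^ Suc i) \<longlongrightarrow> 1 / Suc i) at_top"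
proof -
  let ?T = "\<lambda>x::real. (\<Sum>m | 1 \<le> m \<and> real m \<le> x. ln (x / m) ^ i / m)"
  have "((\<lambda>x. ?T x / ln x ^ Suc i - 1 / Suc i) \<longlongrightarrow> 0) at_top"
  proof (rule Lim_null_comparison)
    have "((\<lambda>x::real. 1 / ln x ^ Suc 0 + 1 / ln x ^ Suc i) \<longlongrightarrow> 0 + 0) at_top"
      by (intro tendsto_add tendsto_const_div_ln_power)
    then show "((\<lambda>x::real. 1 / ln x + 1 / ln x ^ Suc i) \<longlongrightarrow> 0) at_top" by simp
    show "eventually (\<lambda>x. norm (?T x / ln x ^ Suc i - 1 / Suc i) \<le> 1 / ln x + 1 / ln x ^ Suc i) at_top"
      using eventually_gt_at_top[of 1]
    proof eventually_elim
      case (elim x)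
      then have L: "ln x > 0" by simp
      have "norm (?T x / ln x ^ Suc i - 1 / Suc i) = \<bar>?T x - ln x ^ Suc i / Suc i\<bar> / ln x ^ Suc i"
      proof -
        have "t / P - 1 / Suc i = (t - P / Suc i) / P" if "P > 0" for t P :: real
          using that by (simp add: diff_divide_distrib)
        from this[of "ln x ^ Suc i" "?T x"] show ?thesis
          using L by (simp only: real_norm_def abs_divide zero_less_power abs_of_pos)
      qed
      also have "\<dots> \<le> (ln x ^ i + 1) / ln x ^ Suc i"
        using L log_power_sum_bounds[of x i] elim by (intro divide_right_mono) auto
      also have "\<dots> = 1 / ln x + 1 / ln x ^ Suc i"
        using L by (simp add: field_simps)
      finally show ?case .
    qed
  qed
  then show ?thesis by (rule LIM_zero_cancel)
qed

text \<open>The asymptotics of \<open>F\<close> is applied at \<open>x / m\<close>. Where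
  \<open>x / m\<close> is small it says nothing, but an error of at most \<open>C\<close> for each
  \<open>m\<close> suffices there: the total \<open>C * x\<close> is negligible against
  \<open>x * ln x ^ Suc i\<close>. The main terms add up to \<open>B * x * T x\<close>, and
  \<open>T\<close> brings the factor \<open>1 / Suc i\<close>.\<close>

lemma upto_sum_convolution_tendsto:
  assumes lim: "((\<lambda>x. upto_sum F x / (x * ln x ^ i)) \<longlongrightarrow> B) at_top"
  shows "((\<lambda>x. upto_sum (\<lambda>n. \<Sum>d | d dvd n. F d) x / (x * ln x ^ Suc i)) \<longlongrightarrow> B / Suc i) at_top"
proof -
  let ?N = "\<lambda>x::real. {m. 1 \<le> m \<and> real m \<le> x}"
  define T where "T x = (\<Sum>m\<in>?N x. ln (x / real m) ^ i / real m)" for x :: real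
  define S where "S x = upto_sum (\<lambda>n. \<Sum>d | d dvd n. F d) x" for x
  have T: "((\<lambda>x. T x / ln x ^ Suc i) \<longlongrightarrow> 1 / Suc i) at_top"
    using log_power_sum_tendsto unfolding T_def .
  have "((\<lambda>x. S x / (x * ln x ^ Suc i) - B * (T x / ln x ^ Suc i)) \<longlongrightarrow> 0) at_top"
  proof (rule tendstoI)
    fix e :: real assume e: "e > 0"
    define \<epsilon> where "\<epsilon> = e / 4"
    have \<epsilon>: "\<epsilon> > 0" using e by (simp add: \<epsilon>_def)
    have "eventually (\<lambda>x. dist (upto_sum F x / (x * ln x ^ i)) B < \<epsilon>) at_top"
      using lim \<epsilon> by (rule tendstoD)
    then obtain Y where Y: "\<And>x. x \<ge> Y \<Longrightarrow> dist (upto_sum F x / (x * ln x ^ i)) B < \<epsilon>"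
      unfolding eventually_at_top_linorder by blast
    define Y' where "Y' = max Y 2"
    \<comment> \<open>For \<open>1 \<le> y < Y'\<close> the two summands bound the summatory
      function and the main term separately, by monotonicity in \<open>y\<close>.\<close>
    define C where "C = (\<Sum>n | 1 \<le> n \<and> real n \<le> Y'. \<bar>F n\<bar>) + \<bar>B\<bar> * Y' * ln Y' ^ i"
    have C0: "C \<ge> 0"
      unfolding C_def by (intro add_nonneg_nonneg sum_nonneg mult_nonneg_nonneg zero_le_power) (auto simp: Y'_def)
    have pt: "\<bar>upto_sum F y - B * (y * ln y ^ i)\<bar> \<le> \<epsilon> * (y * ln y ^ i) + C" if y: "y \<ge> 1" for y
    proof (cases "y \<ge> Y'")
      case True
      then have "y \<ge> Y" "y > 1" by (auto simp: Y'_def)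
      define D where "D = y * ln y ^ i"
      have D: "D > 0" using \<open>y > 1\<close> by (simp add: D_def)
      have "\<bar>upto_sum F y / D - B\<bar> < \<epsilon>" using Y[OF \<open>y \<ge> Y\<close>] by (simp add: dist_real_def D_def)
      moreover have "upto_sum F y / D - B = (upto_sum F y - B * D) / D" using D by (simp add: field_simps)
      ultimately have "\<bar>upto_sum F y - B * D\<bar> < \<epsilon> * D" using D by (simp add: abs_divide field_simps)
      then show ?thesis using C0 by (simp add: D_def)
    next
      case False
      have "\<bar>upto_sum F y\<bar> \<le> (\<Sum>n\<in>?N y. \<bar>F n\<bar>)" unfolding upto_sum_def by (rule sum_abs)
      also have "\<dots> \<le> (\<Sum>n\<in>?N Y'. \<bar>F n\<bar>)"
        by (intro sum_mono2 finite_upto) (use False in auto)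
      finally have "\<bar>upto_sum F y\<bar> \<le> (\<Sum>n\<in>?N Y'. \<bar>F n\<bar>)" .
      moreover have "\<bar>B * (y * ln y ^ i)\<bar> \<le> \<bar>B\<bar> * Y' * ln Y' ^ i"
      proof -
        have "\<bar>B * (y * ln y ^ i)\<bar> = \<bar>B\<bar> * y * ln y ^ i" using y by (simp add: abs_mult)
        also have "\<dots> \<le> \<bar>B\<bar> * Y' * ln Y' ^ i"
          using y False by (intro mult_mono power_mono mult_nonneg_nonneg) auto
        finally show ?thesis .
      qed
      ultimately have "\<bar>upto_sum F y - B * (y * ln y ^ i)\<bar> \<le> C" unfolding C_def by linarith
      moreover have "\<epsilon> * (y * ln y ^ i) \<ge> 0" using \<epsilon> y by simp
      ultimately show ?thesis by linarith
    qed
    have ev1: "eventually (\<lambda>x. T x / ln x ^ Suc i < 2) at_top"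
      by (rule order_tendstoD(2)[OF T]) (simp add: field_simps)
    have ev2: "eventually (\<lambda>x. C / ln x ^ Suc i < \<epsilon>) at_top"
      by (rule order_tendstoD(2)[OF tendsto_const_div_ln_power \<epsilon>])
    show "eventually (\<lambda>x. dist (S x / (x * ln x ^ Suc i) - B * (T x / ln x ^ Suc i)) 0 < e) at_top"
      using ev1 ev2 eventually_gt_at_top[of 1]
    proof eventually_elim
      case (elim x)
      then have x: "x > 1" and L: "ln x > 0" by auto
      have xT: "x * T x = (\<Sum>m\<in>?N x. x / real m * ln (x / real m) ^ i)"
        by (simp add: T_def sum_distrib_left)
      have "\<bar>S x - B * (x * T x)\<bar> = \<bar>\<Sum>m\<in>?N x. upto_sum F (x / real m) - B * (x / real m * ln (x / real m) ^ i)\<bar>"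
        by (simp add: S_def upto_sum_divisors xT sum_subtractf sum_distrib_left)
      also have "\<dots> \<le> (\<Sum>m\<in>?N x. \<bar>upto_sum F (x / real m) - B * (x / real m * ln (x / real m) ^ i)\<bar>)"
        by (rule sum_abs)
      also have "\<dots> \<le> (\<Sum>m\<in>?N x. \<epsilon> * (x / real m * ln (x / real m) ^ i) + C)"
        by (intro sum_mono pt) (auto simp: field_simps)
      also have "\<dots> = \<epsilon> * (x * T x) + of_int \<lfloor>x\<rfloor> * C"
        using x card_upto[of x] by (simp add: xT sum.distrib sum_distrib_left)
      also have "\<dots> \<le> \<epsilon> * (x * T x) + x * C"
        using C0 by (intro add_left_mono mult_right_mono) auto
      finally have "\<bar>S x - B * (x * T x)\<bar> \<le> x * (\<epsilon> * T x + C)" by (simp add: algebra_simps)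
      then have "\<bar>S x - B * (x * T x)\<bar> / (x * ln x ^ Suc i) \<le> x * (\<epsilon> * T x + C) / (x * ln x ^ Suc i)"
        using x L by (intro divide_right_mono) auto
      also have "\<dots> = \<epsilon> * (T x / ln x ^ Suc i) + C / ln x ^ Suc i"
        using x by (simp add: add_divide_distrib)
      also have "\<dots> < \<epsilon> * 2 + \<epsilon>"
        using elim \<epsilon> by (intro add_strict_mono mult_strict_left_mono) auto
      also have "\<dots> < e" using e by (simp add: \<epsilon>_def)
      also have "\<bar>S x - B * (x * T x)\<bar> / (x * ln x ^ Suc i) = dist (S x / (x * ln x ^ Suc i) - B * (T x / ln x ^ Suc i)) 0"
      proof -
        have "S x / (x * ln x ^ Suc i) - B * (T x / ln x ^ Suc i) = (S x - B * (x * T x)) / (x * ln x ^ Suc i)"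
          using x by (simp add: diff_divide_distrib)
        moreover have "x * ln x ^ Suc i > 0" using x L by simp
        ultimately show ?thesis by (simp add: abs_divide del: power_Suc)
      qed
      finally show ?case .
    qed
  qed
  moreover have "((\<lambda>x. B * (T x / ln x ^ Suc i)) \<longlongrightarrow> B * (1 / Suc i)) at_top"
    by (intro tendsto_mult tendsto_const T)
  ultimately have "((\<lambda>x. (S x / (x * ln x ^ Suc i) - B * (T x / ln x ^ Suc i)) + B * (T x / ln x ^ Suc i)) \<longlongrightarrow> 0 + B * (1 / Suc i)) at_top"
    by (rule tendsto_add)
  then show ?thesis by (simp add: S_def)
qed

section \<open>Euler products with local factors 1 + O(1/p^2)\<close>

lemma prime_power_prod_divide:
  assumes "d > 0"
  shows "prime_power_prod (\<lambda>p i. f i / real p ^ i) d = prime_power_prod (\<lambda>_. f) d / real d"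
proof -
  have "real d = (\<Prod>p\<in>prime_factors d. real p ^ multiplicity p d)"
    using prime_factorization_nat[OF assms] by (metis (no_types, lifting) of_nat_power of_nat_prod prod.cong)
  then show ?thesis unfolding prime_power_prod_def prod_dividef by simp
qed

lemma abs_prime_power_prod:
  "\<bar>prime_power_prod (\<lambda>_. f) d\<bar> = prime_power_prod (\<lambda>_ i. \<bar>f i :: real\<bar>) d"
  by (simp add: prime_power_prod_def abs_prod)

context
  fixes f :: "nat \<Rightarrow> real" and K :: nat
  assumes f0: "f 0 = 1" and f1: "f 1 = 0" and fK: "\<And>i. i > K \<Longrightarrow> f i = 0"
begin

text \<open>
  As \<open>f\<close> vanishes beyond \<open>K\<close>, this finite set carries the whole sum over the integers with all prime
  factors at most \<open>N\<close>.
\<close>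
definition smooth_divisors :: "nat \<Rightarrow> nat set" where
  "smooth_divisors N = {d. d dvd (\<Prod>p | prime p \<and> p \<le> N. p ^ K)}"

lemma smooth_modulus_pos: "(\<Prod>p | prime p \<and> p \<le> N. p ^ K) > (0 :: nat)"
  by (intro prod_pos) (auto simp: prime_gt_0_nat)

lemma finite_smooth_divisors: "finite (smooth_divisors N)"
  unfolding smooth_divisors_def using smooth_modulus_pos by (rule finite_divisors_nat)

lemma sum_smooth_divisors:
  assumes "g 0 = 1"
  shows "(\<Sum>d\<in>smooth_divisors N. prime_power_prod (\<lambda>_. g) d / real d) =
    (\<Prod>p | prime p \<and> p \<le> N. \<Sum>i\<le>K. g i / real p ^ i)"
proof -
  let ?P = "{p. prime p \<and> p \<le> N}" and ?M = "\<Prod>p | prime p \<and> p \<le> N. p ^ K"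
  have finP: "finite ?P" by (rule finite_subset[of _ "{..N}"]) auto
  have mult: "multiplicity p ?M = (if p \<in> ?P then K else 0)" if "prime p" for p
    using multiplicity_prod_prime_powers[OF finP _ that, of "\<lambda>_. K"] by simp
  have "(\<Sum>d\<in>smooth_divisors N. prime_power_prod (\<lambda>_. g) d / real d) =
     (\<Sum>d | d dvd ?M. prime_power_prod (\<lambda>p i. g i / real p ^ i) d)"
    unfolding smooth_divisors_def
  proof (intro sum.cong refl)
    fix d assume "d \<in> {d. d dvd ?M}"
    then have "d > 0" using smooth_modulus_pos[of N] by (auto intro!: Nat.gr0I)
    then show "prime_power_prod (\<lambda>_. g) d / real d = prime_power_prod (\<lambda>p i. g i / real p ^ i) d"
      by (rule prime_power_prod_divide[symmetric])
  qed
  also have "\<dots> = prime_power_prod (\<lambda>p a. \<Sum>i\<le>a. g i / real p ^ i) ?M"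
    by (rule sum_divisors_prime_power_prod) (simp_all add: assms smooth_modulus_pos)
  also have "\<dots> = (\<Prod>p\<in>?P. \<Sum>i\<le>multiplicity p ?M. g i / real p ^ i)"
    unfolding prime_power_prod_def
  proof (intro prod.mono_neutral_left finP ballI)
    show "prime_factors ?M \<subseteq> ?P"
    proof
      fix p assume p: "p \<in> prime_factors ?M"
      then have "multiplicity p ?M > 0" by (simp add: prime_factors_multiplicity)
      then show "p \<in> ?P" using mult[OF in_prime_factors_imp_prime[OF p]] by presburger
    qed
    fix p assume p: "p \<in> ?P - prime_factors ?M"
    then have "multiplicity p ?M = 0" by (auto simp: prime_factors_multiplicity)
    then show "(\<Sum>i\<le>multiplicity p ?M. g i / real p ^ i) = 1" using assms by simp
  qed
  also have "\<dots> = (\<Prod>p\<in>?P. \<Sum>i\<le>K. g i / real p ^ i)"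
    by (intro prod.cong refl) (simp add: mult)
  finally show ?thesis .
qed

text \<open>As \<open>f 1 = 0\<close>, no term of order \<open>1/p\<close> is present, which makes
  the Euler product converge absolutely. The function \<open>g\<close> stands for \<open>f\<close>
  or its absolute value.\<close>

lemma local_factor_bound:
  assumes "p > 0" "\<And>i. \<bar>g i\<bar> \<le> \<bar>f i\<bar>" "g 0 = 1"
  shows "\<bar>(\<Sum>i\<le>K. g i / real p ^ i) - 1\<bar> \<le> (\<Sum>i\<le>K. \<bar>f i\<bar>) / real p ^ 2"
proof -
  have "(\<Sum>i\<le>K. g i / real p ^ i) = g 0 / real p ^ 0 + (\<Sum>i\<in>{..K} - {0}. g i / real p ^ i)"
    by (rule sum.remove) auto
  then have "\<bar>(\<Sum>i\<le>K. g i / real p ^ i) - 1\<bar> = \<bar>\<Sum>i\<in>{..K} - {0}. g i / real p ^ i\<bar>"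
    using assms(3) by simp
  also have "\<dots> \<le> (\<Sum>i\<in>{..K} - {0}. \<bar>g i / real p ^ i\<bar>)" by (rule sum_abs)
  also have "\<dots> \<le> (\<Sum>i\<in>{..K} - {0}. \<bar>f i\<bar> / real p ^ 2)"
  proof (intro sum_mono)
    fix i assume i: "i \<in> {..K} - {0}"
    show "\<bar>g i / real p ^ i\<bar> \<le> \<bar>f i\<bar> / real p ^ 2"
    proof (cases "i = 1")
      case True
      then show ?thesis using assms(2)[of 1] f1 by simp
    next
      case False
      with i have "i \<ge> 2" by auto
      then have "real p ^ 2 \<le> real p ^ i" using assms(1) by (intro power_increasing) auto
      then have "\<bar>g i\<bar> / real p ^ i \<le> \<bar>f i\<bar> / real p ^ 2"
        using assms(1,2) by (intro frac_le) auto
      then show ?thesis by (simp add: abs_divide)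
    qed
  qed
  also have "\<dots> \<le> (\<Sum>i\<le>K. \<bar>f i\<bar> / real p ^ 2)"
    by (intro sum_mono2) auto
  finally show ?thesis by (simp add: sum_divide_distrib)
qed

lemma in_smooth_divisors:
  assumes "d > 0" "prime_power_prod (\<lambda>_. f) d \<noteq> 0" "d \<le> N"
  shows "d \<in> smooth_divisors N"
  unfolding smooth_divisors_def
proof (rule CollectI, rule multiplicity_le_imp_dvd)
  fix p :: nat assume p: "prime p"
  have finP: "finite {p. prime p \<and> p \<le> N}" by (rule finite_subset[of _ "{..N}"]) auto
  show "multiplicity p d \<le> multiplicity p (\<Prod>p | prime p \<and> p \<le> N. p ^ K)"
  proof (cases "p \<in> prime_factors d")
    case True
    then have "p \<le> N" using assms(1,3) by (auto dest!: dvd_imp_le)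
    moreover have "f (multiplicity p d) \<noteq> 0"
      using assms(2) True by (simp add: prime_power_prod_def)
    then have "multiplicity p d \<le> K" using fK not_le by blast
    ultimately show ?thesis
      using multiplicity_prod_prime_powers[OF finP _ p, of "\<lambda>_. K"] p by simp
  next
    case False
    then show ?thesis using p by (simp add: prime_factors_multiplicity)
  qed
qed (use assms in simp)

lemma summable_inverse_squares: "summable (\<lambda>p. B / real p ^ 2)"
  using summable_mult[OF inverse_power_summable[of 2, where 'a = real], of B]
  by (simp add: divide_inverse)

text \<open>The support up to \<open>N\<close> lies in \<open>smooth_divisors N\<close>, so a
  partial sum is at most a finite Euler product, and \<open>1 + t \<le> exp t\<close> bounds this
  through the convergent sum of inverse squares.\<close>

lemma summable_prime_power_prod: "summable (\<lambda>d. \<bar>prime_power_prod (\<lambda>_. f) d\<bar> / real d)"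
proof -
  define F where "F = (\<lambda>d. \<bar>prime_power_prod (\<lambda>_. f) d\<bar> / real d)"
  define B where "B = (\<Sum>i\<le>K. \<bar>f i\<bar>)"
  have B0: "B \<ge> 0" unfolding B_def by (intro sum_nonneg) auto
  have F0: "F d \<ge> 0" for d by (simp add: F_def)
  have bound: "sum F {..N} \<le> exp (\<Sum>p. B / real p ^ 2)" for N
  proof -
    let ?P = "{p. prime p \<and> p \<le> N}"
    have finP: "finite ?P" by (rule finite_subset[of _ "{..N}"]) auto
    have "sum F {..N} = sum F {d\<in>{..N}. d > 0 \<and> prime_power_prod (\<lambda>_. f) d \<noteq> 0}"
      by (intro sum.mono_neutral_right) (auto simp: F_def)
    also have "\<dots> \<le> sum F (smooth_divisors N)"
      by (intro sum_mono2 finite_smooth_divisors) (auto intro: in_smooth_divisors F0)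
    also have "\<dots> = (\<Prod>p\<in>?P. \<Sum>i\<le>K. \<bar>f i\<bar> / real p ^ i)"
      unfolding F_def abs_prime_power_prod by (rule sum_smooth_divisors) (simp add: f0)
    also have "\<dots> \<le> (\<Prod>p\<in>?P. 1 + B / real p ^ 2)"
    proof (intro prod_mono conjI)
      fix p assume "p \<in> ?P"
      then have "p > 0" by (auto simp: prime_gt_0_nat)
      then show "(\<Sum>i\<le>K. \<bar>f i\<bar> / real p ^ i) \<le> 1 + B / real p ^ 2"
        using local_factor_bound[of p "\<lambda>i. \<bar>f i\<bar>"] f0 by (simp add: B_def abs_le_iff)
    qed (auto intro!: sum_nonneg)
    also have "\<dots> \<le> exp (\<Sum>p\<in>?P. B / real p ^ 2)"
      using B0 by (intro prod_le_exp_sum) auto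
    also have "(\<Sum>p\<in>?P. B / real p ^ 2) \<le> (\<Sum>p. B / real p ^ 2)"
      using B0 finP by (intro sum_le_suminf summable_inverse_squares) auto
    finally show ?thesis by simp
  qed
  show ?thesis
    using bounded_imp_summable[OF F0 bound] unfolding F_def .
qed

lemma convergent_euler_product:
  "convergent_prod (\<lambda>p. if prime p then \<Sum>i\<le>K. f i / real p ^ i else 1)"
proof (rule abs_convergent_prod_imp_convergent_prod, rule summable_imp_abs_convergent_prod)
  have B0: "(\<Sum>i\<le>K. \<bar>f i\<bar>) \<ge> 0" by (intro sum_nonneg) auto
  show "summable (\<lambda>p. norm ((if prime p then \<Sum>i\<le>K. f i / real p ^ i else 1) - 1))"
  proof (rule summable_comparison_test[OF _ summable_inverse_squares])
    show "\<exists>N. \<forall>p\<ge>N. norm (norm ((if prime p then \<Sum>i\<le>K. f i / real p ^ i else 1) - 1))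
        \<le> (\<Sum>i\<le>K. \<bar>f i\<bar>) / real p ^ 2"
      using local_factor_bound[of _ f] f0 B0 by (intro exI[of _ 1]) auto
  qed
qed

text \<open>Absolute convergence permits summation along any exhaustion of a set containing the
  support; along \<open>smooth_divisors N\<close> the partial sums are exactly the finite Euler
  products.\<close>

lemma euler_product:
  "(\<Sum>d. prime_power_prod (\<lambda>_. f) d / real d) =
    (\<Prod>p. if prime p then \<Sum>i\<le>K. f i / real p ^ i else 1)"
proof -
  define F where "F d = prime_power_prod (\<lambda>_. f) d / real d" for d
  define D where "D = (\<Union>N. smooth_divisors N)"
  have "summable (\<lambda>d. norm (F d))" using summable_prime_power_prod by (simp add: F_def)
  from norm_summable_imp_has_sum[OF this summable_sums[OF summable_norm_cancel[OF this]]]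
  have "(F has_sum (\<Sum>d. F d)) UNIV" .
  moreover have "F d = 0" if "d \<notin> D" for d
    using in_smooth_divisors[of d d] that by (cases "d = 0") (auto simp: F_def D_def)
  ultimately have "(F has_sum (\<Sum>d. F d)) D"
    by (subst has_sum_cong_neutral[of UNIV D F F]) auto
  then have lim: "(sum F \<longlongrightarrow> (\<Sum>d. F d)) (finite_subsets_at_top D)" by (simp add: has_sum_def)
  have mono: "smooth_divisors N \<subseteq> smooth_divisors N'" if "N \<le> N'" for N N'
    unfolding smooth_divisors_def
  proof (intro Collect_mono impI)
    fix d assume d: "d dvd (\<Prod>p | prime p \<and> p \<le> N. p ^ K)"
    have "finite {p. prime p \<and> p \<le> N'}" by (rule finite_subset[of _ "{..N'}"]) auto
    then have "(\<Prod>p | prime p \<and> p \<le> N. p ^ K) dvd (\<Prod>p | prime p \<and> p \<le> N'. p ^ K)"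
      using that by (intro prod_dvd_prod_subset) auto
    with d show "d dvd (\<Prod>p | prime p \<and> p \<le> N'. p ^ K)" by (rule dvd_trans)
  qed
  have "filterlim smooth_divisors (finite_subsets_at_top D) sequentially"
    unfolding filterlim_finite_subsets_at_top
  proof (intro allI impI)
    fix X assume X: "finite X \<and> X \<subseteq> D"
    then have "finite X" "X \<subseteq> D" by auto
    then have "\<exists>N. X \<subseteq> smooth_divisors N"
    proof (induction X rule: finite_induct)
      case (insert x X)
      then obtain N N' where "X \<subseteq> smooth_divisors N" "x \<in> smooth_divisors N'" by (auto simp: D_def)
      then have "insert x X \<subseteq> smooth_divisors (max N N')"
        using mono[of N "max N N'"] mono[of N' "max N N'"] by auto
      then show ?case by blast
    qed auto
    then obtain N where N: "X \<subseteq> smooth_divisors N" by blast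
    show "eventually (\<lambda>n. finite (smooth_divisors n) \<and> X \<subseteq> smooth_divisors n \<and> smooth_divisors n \<subseteq> D) sequentially"
      using eventually_ge_at_top[of N]
      by eventually_elim (use N mono in \<open>auto simp: finite_smooth_divisors D_def\<close>)
  qed
  from filterlim_compose[OF lim this]
  have lim1: "(\<lambda>N. sum F (smooth_divisors N)) \<longlonglongrightarrow> (\<Sum>d. F d)" .
  let ?a = "\<lambda>p. if prime p then \<Sum>i\<le>K. f i / real p ^ i else 1"
  have "sum F (smooth_divisors N) = (\<Prod>p\<le>N. ?a p)" for N
  proof -
    have "sum F (smooth_divisors N) = (\<Prod>p | prime p \<and> p \<le> N. ?a p)"
      unfolding F_def sum_smooth_divisors[of f, OF f0] by (intro prod.cong) auto
    also have "\<dots> = (\<Prod>p\<le>N. ?a p)" by (intro prod.mono_neutral_left) auto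
    finally show ?thesis .
  qed
  with lim1 have "(\<lambda>N. \<Prod>p\<le>N. ?a p) \<longlonglongrightarrow> (\<Sum>d. F d)" by simp
  then show ?thesis
    using convergent_prod_LIMSEQ[OF convergent_euler_product] LIMSEQ_unique by (auto simp: F_def)
qed

end

text \<open>With \<open>k = m + 1\<close>, the local series of \<open>k ^ \<omega>(n)\<close> is
  \<open>1 + k x / (1 - x) = (1 + m x) / (1 - x)\<close>. Multiplied by
  \<open>(1 - x) ^ (j + 1)\<close> it becomes \<open>kernel_poly m j\<close>, which thus describes
  what is left after removing \<open>j + 1\<close> convolution factors 1.\<close>

definition kernel_poly :: "nat \<Rightarrow> nat \<Rightarrow> real poly" where
  "kernel_poly m j = [:1, real m:] * [:1, -1:] ^ j"

lemma sum_coeff_mult_one_minus_x: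
  fixes q :: "'a :: comm_ring_1 poly"
  shows "(\<Sum>i\<le>a. coeff ([:1, -1:] * q) i) = coeff q a"
  by (induction a) (simp_all add: coeff_pCons)

lemma kernel_poly_Suc: "kernel_poly m (Suc j) = [:1, -1:] * kernel_poly m j"
  unfolding kernel_poly_def power_Suc by (simp only: mult_ac)

lemma coeff_0_kernel_poly [simp]: "coeff (kernel_poly m j) 0 = 1"
  by (simp add: kernel_poly_def poly_0_coeff_0[symmetric])

definition kernel_fun :: "nat \<Rightarrow> nat \<Rightarrow> nat \<Rightarrow> real" where
  "kernel_fun m j = prime_power_prod (\<lambda>_. coeff (kernel_poly m j))"

lemma sum_divisors_kernel_fun_Suc:
  assumes "n > 0"
  shows "(\<Sum>d | d dvd n. kernel_fun m (Suc j) d) = kernel_fun m j n"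
proof -
  have "(\<Sum>d | d dvd n. kernel_fun m (Suc j) d) =
     prime_power_prod (\<lambda>_ a. \<Sum>i\<le>a. coeff (kernel_poly m (Suc j)) i) n"
    unfolding kernel_fun_def by (rule sum_divisors_prime_power_prod) (simp_all add: assms)
  then show ?thesis by (simp add: kernel_poly_Suc sum_coeff_mult_one_minus_x kernel_fun_def del: mult_pCons_left)
qed

lemma sum_divisors_kernel_fun_0:
  assumes "n > 0"
  shows "(\<Sum>d | d dvd n. kernel_fun m 0 d) = real (Suc m) ^ card (prime_factors n)"
proof -
  have partial: "(\<Sum>i\<le>a. coeff (kernel_poly m 0) i) = real (Suc m)" if "a > 0" for a
    using that
  proof (induction a rule: nat_induct_non_zero)
    case (Suc a)
    then show ?case by (cases a) (auto simp: kernel_poly_def coeff_pCons)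
  qed (simp add: kernel_poly_def)
  have "(\<Sum>d | d dvd n. kernel_fun m 0 d) = prime_power_prod (\<lambda>_ a. \<Sum>i\<le>a. coeff (kernel_poly m 0) i) n"
    unfolding kernel_fun_def by (rule sum_divisors_prime_power_prod) (simp_all add: assms)
  also have "\<dots> = (\<Prod>p\<in>prime_factors n. real (Suc m))"
    unfolding prime_power_prod_def
    by (intro prod.cong refl partial) (simp add: prime_factors_multiplicity)
  finally show ?thesis by simp
qed

definition euler_const :: "nat \<Rightarrow> real" where
  "euler_const m = (\<Prod>p. if prime p then (1 + real m / real p) * (1 - 1 / real p) ^ m else 1)"

text \<open>The choice \<open>j = m\<close> makes the linear coefficient \<open>m - j\<close>
  vanish, as the Euler product requires; the local factor is the value of the polynomial at
  \<open>1/p\<close>.\<close>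

lemma kernel_poly_diagonal:
  "coeff (kernel_poly m m) 1 = 0" "i > Suc m \<Longrightarrow> coeff (kernel_poly m m) i = 0"
  "(\<Sum>i\<le>Suc m. coeff (kernel_poly m m) i / real p ^ i) = (1 + real m / real p) * (1 - 1 / real p) ^ m"
proof -
  have "coeff ([:1, -1 :: real:] ^ j) 1 = - real j" for j
  proof (induction j)
    case (Suc j)
    have "coeff ([:1, -1 :: real:] ^ j) 0 = 1" by (simp add: poly_0_coeff_0[symmetric])
    with Suc show ?case by (simp add: coeff_pCons)
  qed simp
  then show "coeff (kernel_poly m m) 1 = 0"
    by (simp add: kernel_poly_def coeff_pCons poly_0_coeff_0[symmetric])
  have "degree (kernel_poly m m) \<le> degree [:1, real m:] + degree ([:1, -1 :: real:] ^ m)"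
    unfolding kernel_poly_def by (rule degree_mult_le)
  also have "\<dots> \<le> 1 + m" by (intro add_mono) (auto simp: degree_power_eq)
  finally have deg: "degree (kernel_poly m m) \<le> Suc m" by simp
  then show "coeff (kernel_poly m m) i = 0" if "i > Suc m" using that by (intro coeff_eq_0) simp
  have "(\<Sum>i\<le>Suc m. coeff (kernel_poly m m) i / real p ^ i) = poly (kernel_poly m m) (1 / real p)"
    unfolding poly_altdef
    by (rule sum.mono_neutral_cong_right) (use deg in \<open>auto simp: power_one_over power_inverse divide_inverse coeff_eq_0\<close>)
  also have "\<dots> = (1 + real m / real p) * (1 - 1 / real p) ^ m"
    unfolding kernel_poly_def poly_mult poly_power by simp
  finally show "(\<Sum>i\<le>Suc m. coeff (kernel_poly m m) i / real p ^ i) = (1 + real m / real p) * (1 - 1 / real p) ^ m" .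
qed

text \<open>A product that converges in the sense of \<open>convergent_prod\<close> vanishes only if
  a factor does. This allows division by \<open>c r\<close> in the asymptotic equivalence.\<close>

lemma euler_const_nonzero: "euler_const m \<noteq> 0"
proof -
  have "convergent_prod (\<lambda>p. if prime p then (1 + real m / real p) * (1 - 1 / real p) ^ m else 1)"
    using convergent_euler_product[where K = "Suc m", OF coeff_0_kernel_poly[of m m] kernel_poly_diagonal(1,2)]
    unfolding kernel_poly_diagonal(3) .
  moreover have "(if prime p then (1 + real m / real p) * (1 - 1 / real p) ^ m else 1) \<noteq> 0" for p
  proof -
    have "1 + real m / real p > 0" by (simp add: add_pos_nonneg)
    moreover have "1 - 1 / real p > 0" if "prime p" using prime_gt_1_nat[OF that] by simp
    ultimately show ?thesis by (cases "prime p") auto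
  qed
  ultimately show ?thesis unfolding euler_const_def by (rule prodinf_nonzero)
qed

text \<open>The convolution of \<open>kernel_fun m m\<close> with 1 has an asymptotically linear
  summatory function, and \<open>m\<close> further convolutions lead to
  \<open>Suc m ^ \<omega>(n)\<close>. The \<open>i\<close>-th of them divides the constant by
  \<open>i\<close>, whence \<open>fact m\<close>.\<close>

lemma upto_sum_power_omega_tendsto:
  "((\<lambda>x. upto_sum (\<lambda>n. real (Suc m) ^ card (prime_factors n)) x / (x * ln x ^ m))
     \<longlongrightarrow> euler_const m / fact m) at_top"
proof -
  have cong: "upto_sum F = upto_sum G" if "\<And>n. n > 0 \<Longrightarrow> F n = G n" for F G
    unfolding upto_sum_def by (intro ext sum.cong) (use that in auto)
  have "((\<lambda>x. upto_sum (\<lambda>n. \<Sum>d | d dvd n. kernel_fun m (m - i) d) x / (x * ln x ^ i))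
      \<longlongrightarrow> euler_const m / fact i) at_top" if "i \<le> m" for i
    using that
  proof (induction i)
    case 0
    have "summable (\<lambda>d. \<bar>kernel_fun m m d\<bar> / real d)"
      unfolding kernel_fun_def
      by (rule summable_prime_power_prod[of _ "Suc m"]) (use kernel_poly_diagonal in auto)
    from upto_sum_divisors_tendsto[OF this]
    have "((\<lambda>x. upto_sum (\<lambda>n. \<Sum>d | d dvd n. kernel_fun m m d) x / x)
       \<longlongrightarrow> (\<Sum>d. kernel_fun m m d / real d)) at_top" .
    also have "(\<Sum>d. kernel_fun m m d / real d) = euler_const m"
      using euler_product[where K = "Suc m", OF coeff_0_kernel_poly[of m m] kernel_poly_diagonal(1,2)]
      unfolding kernel_poly_diagonal(3) kernel_fun_def euler_const_def .
    finally show ?case by simp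
  next
    case (Suc i)
    then have Suc_diff: "m - i = Suc (m - Suc i)" by simp
    have "upto_sum (\<lambda>n. \<Sum>d | d dvd n. kernel_fun m (m - i) d) = upto_sum (kernel_fun m (m - Suc i))"
      unfolding Suc_diff by (rule cong) (rule sum_divisors_kernel_fun_Suc)
    with Suc have "((\<lambda>x. upto_sum (kernel_fun m (m - Suc i)) x / (x * ln x ^ i))
      \<longlongrightarrow> euler_const m / fact i) at_top" by simp
    from upto_sum_convolution_tendsto[OF this] show ?case by (simp add: field_simps)
  qed
  from this[of m] have "((\<lambda>x. upto_sum (\<lambda>n. \<Sum>d | d dvd n. kernel_fun m 0 d) x / (x * ln x ^ m))
      \<longlongrightarrow> euler_const m / fact m) at_top" by simp
  moreover have "upto_sum (\<lambda>n. \<Sum>d | d dvd n. kernel_fun m 0 d) = upto_sum (\<lambda>n. real (Suc m) ^ card (prime_factors n))"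
    by (rule cong) (rule sum_divisors_kernel_fun_0)
  ultimately show ?thesis by simp
qed

section \<open>The average order of \<open>H r n\<close>\<close>

text \<open>The coefficient estimate for an arbitrary divisor bounds \<open>H r n\<close> from
  above, and the extremal divisor bounds it from below. The error is written with base
  \<open>2 ^ (r - 1)\<close> so that it can be averaged by the same result as the main term.\<close>

lemma H_estimate:
  assumes r: "r \<ge> 1"
  shows "\<exists>C\<ge>0. \<forall>n\<ge>1. \<bar>real_of_int (H r n) - (2 ^ r) ^ card (prime_factors n) / (2 ^ r * fact r)\<bar>
    \<le> C * (2 ^ (r - 1)) ^ card (prime_factors n)"
proof -
  obtain C where C0: "C \<ge> 0" and C: "\<And>n (d::int poly). n > 1 \<Longrightarrow> d dvd monom 1 n - 1 \<Longrightarrow>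
     \<bar>\<bar>real_of_int (coeff d r)\<bar> - real_of_int \<bar>coeff d 1\<bar> ^ r / fact r\<bar> * (2 ^ card (prime_factors n) / 2)
       \<le> C * (2 ^ card (prime_factors n) / 2) ^ r \<and>
     real_of_int \<bar>coeff d 1\<bar> \<le> 2 ^ card (prime_factors n) / 2"
    using coeff_divisor_estimate[of r] by blast
  define E where "E n = \<bar>real_of_int (H r n) - (2 ^ r) ^ card (prime_factors n) / (2 ^ r * fact r)\<bar>" for n
  have main: "E n \<le> C * (2 ^ (r - 1)) ^ card (prime_factors n)" if n: "n > 1" for n
  proof -
    define K :: real where "K = 2 ^ card (prime_factors n) / 2"
    have "prime_factors n \<noteq> {}" using prime_factor_nat[of n] n by (auto simp: prime_factors_dvd)
    then have "card (prime_factors n) \<noteq> 0" by simp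
    then obtain k where "card (prime_factors n) = Suc k" by (cases "card (prime_factors n)") auto
    then have K: "K \<ge> 1" by (simp add: K_def)
    have Kr: "K ^ r = K ^ (r - 1) * K" by (rule power_minus_mult[symmetric]) (use r in simp)
    have est: "\<bar>\<bar>real_of_int (coeff d r)\<bar> - real_of_int \<bar>coeff d 1\<bar> ^ r / fact r\<bar> \<le> C * K ^ (r - 1)"
      and lin: "real_of_int \<bar>coeff d 1\<bar> \<le> K" if "d dvd monom 1 n - 1" for d :: "int poly"
    proof -
      have "\<bar>\<bar>real_of_int (coeff d r)\<bar> - real_of_int \<bar>coeff d 1\<bar> ^ r / fact r\<bar> * K \<le> (C * K ^ (r - 1)) * K"
        using C[OF n that] by (simp add: K_def[symmetric] Kr mult.assoc)
      then show "\<bar>\<bar>real_of_int (coeff d r)\<bar> - real_of_int \<bar>coeff d 1\<bar> ^ r / fact r\<bar> \<le> C * K ^ (r - 1)"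
        using K by simp
      show "real_of_int \<bar>coeff d 1\<bar> \<le> K" using C[OF n that] by (simp add: K_def)
    qed
    define X where "X = {\<bar>coeff d r\<bar> | d :: int poly. d dvd monom 1 n - 1}"
    have upper: "real_of_int y \<le> K ^ r / fact r + C * K ^ (r - 1)" if y: "y \<in> X" for y
    proof -
      obtain d :: "int poly" where d: "d dvd monom 1 n - 1" "y = \<bar>coeff d r\<bar>"
        using y unfolding X_def by blast
      have "real_of_int \<bar>coeff d 1\<bar> ^ r / fact r \<le> K ^ r / fact r"
        using lin[OF d(1)] by (intro divide_right_mono power_mono) auto
      then show ?thesis using est[OF d(1)] unfolding d(2) of_int_abs by linarith
    qed
    have "X \<subseteq> {0..\<lceil>K ^ r / fact r + C * K ^ (r - 1)\<rceil>}"
    proof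
      fix y assume y: "y \<in> X"
      then have "y \<ge> 0" by (auto simp: X_def)
      moreover have "y \<le> \<lceil>K ^ r / fact r + C * K ^ (r - 1)\<rceil>"
        using upper[OF y] by linarith
      ultimately show "y \<in> {0..\<lceil>K ^ r / fact r + C * K ^ (r - 1)\<rceil>}" by simp
    qed
    then have finX: "finite X" by (rule finite_subset) simp
    obtain d :: "int poly" where d: "d dvd monom 1 n - 1" "real_of_int \<bar>coeff d 1\<bar> = K"
      using divisor_extremal_linear_coeff[OF n] unfolding K_def by blast
    then have dX: "\<bar>coeff d r\<bar> \<in> X" by (auto simp: X_def)
    have "Max X \<in> X" using finX dX by (intro Max_in) auto
    then have "real_of_int (H r n) \<le> K ^ r / fact r + C * K ^ (r - 1)"
      unfolding H_def X_def[symmetric] by (rule upper)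
    moreover have "real_of_int \<bar>coeff d r\<bar> \<le> real_of_int (H r n)"
      unfolding H_def X_def[symmetric] using Max_ge[OF finX dX] by (simp only: of_int_le_iff)
    then have "real_of_int (H r n) \<ge> K ^ r / fact r - C * K ^ (r - 1)"
      using est[OF d(1), unfolded d(2)] unfolding of_int_abs by linarith
    ultimately have "\<bar>real_of_int (H r n) - K ^ r / fact r\<bar> \<le> C * K ^ (r - 1)" by linarith
    moreover have "K ^ r / fact r = (2 ^ r) ^ card (prime_factors n) / (2 ^ r * fact r)"
      by (simp add: K_def power_divide mult.commute flip: power_mult)
    moreover have "C * K ^ (r - 1) \<le> C * (2 ^ card (prime_factors n)) ^ (r - 1)"
      using C0 by (intro mult_left_mono power_mono) (auto simp: K_def)
    moreover have "(2 ^ card (prime_factors n)) ^ (r - 1) = ((2::real) ^ (r - 1)) ^ card (prime_factors n)"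
      by (simp add: mult.commute flip: power_mult)
    ultimately show ?thesis unfolding E_def by simp
  qed
  \<comment> \<open>For \<open>n = 1\<close> there is no prime factor and \<open>main\<close> does
    not apply; the error \<open>E 1\<close> is absorbed in the constant, as the power on the right
    is 1 there.\<close>
  show ?thesis
  proof (intro exI[of _ "max C (E 1)"] conjI allI impI)
    show "0 \<le> max C (E 1)" using C0 by simp
    fix n :: nat assume n: "n \<ge> 1"
    have "E n \<le> max C (E 1) * (2 ^ (r - 1)) ^ card (prime_factors n)"
    proof (cases "n = 1")
      case False
      then have "E n \<le> C * (2 ^ (r - 1)) ^ card (prime_factors n)" using n by (intro main) simp
      also have "\<dots> \<le> max C (E 1) * (2 ^ (r - 1)) ^ card (prime_factors n)"
        by (intro mult_right_mono) auto
      finally show ?thesis .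
    qed simp
    then show "\<bar>real_of_int (H r n) - (2 ^ r) ^ card (prime_factors n) / (2 ^ r * fact r)\<bar>
        \<le> max C (E 1) * (2 ^ (r - 1)) ^ card (prime_factors n)"
      by (simp only: E_def)
  qed
qed

lemma c_eq: "c r = euler_const (2 ^ r - 1) / fact (2 ^ r - 1) / (2 ^ r * fact r)"
proof -
  have real_diff: "real (2 ^ r - 1) = 2 ^ r - 1" by (simp add: of_nat_diff)
  show ?thesis unfolding c_def euler_const_def real_diff by (simp add: mult.assoc)
qed

lemma upto_sum_H_tendsto:
  assumes r: "r \<ge> 1"
  shows "((\<lambda>x. upto_sum (\<lambda>n. real_of_int (H r n)) x / (x * ln x ^ (2 ^ r - 1))) \<longlongrightarrow> c r) at_top"
proof -
  define M where "M = (\<lambda>n::nat. real (Suc (2 ^ r - 1)) ^ card (prime_factors n))"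
  define E where "E = (\<lambda>n::nat. real (Suc (2 ^ (r - 1) - 1)) ^ card (prime_factors n))"
  define k :: real where "k = 2 ^ r * fact r"
  define l where "l = (2 ^ (r - 1) :: nat)"
  have l: "l \<ge> 1" by (simp add: l_def)
  have "r = Suc (r - 1)" using r by simp
  then have two_l: "2 ^ r = 2 * l" unfolding l_def by (metis power_Suc)
  obtain C where C0: "C \<ge> 0" and C: "\<And>n. n \<ge> 1 \<Longrightarrow> \<bar>real_of_int (H r n) - M n / k\<bar> \<le> C * E n"
    using H_estimate[OF r] by (auto simp: M_def E_def k_def)
  \<comment> \<open>The exponent splits as \<open>(l - 1) + l\<close>: the error has order
    \<open>x * ln x ^ (l - 1)\<close>, and the surplus \<open>ln x ^ l\<close> makes it negligible.
    The second \<open>l\<close> is written \<open>Suc (l - 1)\<close> to fit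
    \<open>tendsto_const_div_ln_power\<close>.\<close>
  have exponent: "2 ^ r - 1 = (2 ^ (r - 1) - 1) + Suc (l - 1)"
    unfolding two_l l_def[symmetric] using l by linarith
  have lim1: "((\<lambda>x. upto_sum M x / (x * ln x ^ (2 ^ r - 1)) / k) \<longlongrightarrow> c r) at_top"
    unfolding c_eq k_def[symmetric] M_def
    by (intro tendsto_divide upto_sum_power_omega_tendsto tendsto_const) (simp add: k_def)
  have "((\<lambda>x. C * (upto_sum E x / (x * ln x ^ (2 ^ (r - 1) - 1)) * (1 / ln x ^ Suc (l - 1)))) \<longlongrightarrow>
      C * (euler_const (2 ^ (r - 1) - 1) / fact (2 ^ (r - 1) - 1) * 0)) at_top"
    unfolding E_def by (intro tendsto_mult upto_sum_power_omega_tendsto tendsto_const tendsto_const_div_ln_power)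
  then have lim2: "((\<lambda>x. C * upto_sum E x / (x * ln x ^ (2 ^ r - 1))) \<longlongrightarrow> 0) at_top"
    unfolding exponent power_add by (simp add: mult_ac del: power_Suc)
  have "((\<lambda>x. upto_sum (\<lambda>n. real_of_int (H r n)) x / (x * ln x ^ (2 ^ r - 1))
      - upto_sum M x / (x * ln x ^ (2 ^ r - 1)) / k) \<longlongrightarrow> 0) at_top"
  proof (rule Lim_null_comparison[OF _ lim2])
    show "eventually (\<lambda>x. norm (upto_sum (\<lambda>n. real_of_int (H r n)) x / (x * ln x ^ (2 ^ r - 1))
      - upto_sum M x / (x * ln x ^ (2 ^ r - 1)) / k) \<le> C * upto_sum E x / (x * ln x ^ (2 ^ r - 1))) at_top"
      using eventually_gt_at_top[of 1]
    proof eventually_elim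
      case (elim x)
      define D where "D = x * ln x ^ (2 ^ r - 1)"
      have D: "D > 0" using elim by (simp add: D_def)
      have "upto_sum (\<lambda>n. real_of_int (H r n)) x - upto_sum M x / k
         = (\<Sum>n | 1 \<le> n \<and> real n \<le> x. real_of_int (H r n) - M n / k)"
        by (simp add: upto_sum_def sum_subtractf sum_divide_distrib)
      also have "\<bar>\<dots>\<bar> \<le> (\<Sum>n | 1 \<le> n \<and> real n \<le> x. \<bar>real_of_int (H r n) - M n / k\<bar>)"
        by (rule sum_abs)
      also have "\<dots> \<le> (\<Sum>n | 1 \<le> n \<and> real n \<le> x. C * E n)"
        by (intro sum_mono C) auto
      also have "\<dots> = C * upto_sum E x" by (simp add: upto_sum_def sum_distrib_left)
      finally have "\<bar>upto_sum (\<lambda>n. real_of_int (H r n)) x - upto_sum M x / k\<bar> / D \<le> C * upto_sum E x / D"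
        using D by (intro divide_right_mono) auto
      then have "\<bar>(upto_sum (\<lambda>n. real_of_int (H r n)) x - upto_sum M x / k) / D\<bar> \<le> C * upto_sum E x / D"
        using D by (simp add: abs_divide)
      then show ?case unfolding D_def[symmetric] by (simp add: diff_divide_distrib mult.commute)
    qed
  qed
  from tendsto_add[OF this lim1] show ?thesis by simp
qed

theorem theorem1p1:
  fixes r :: nat
  assumes "r \<ge> 1"
  shows "(\<lambda>x :: real. \<Sum>n | 1 \<le> n \<and> real n \<le> x. real_of_int (H r n))
           \<sim>[at_top] (\<lambda>x. c r * x * (ln x) ^ (2 ^ r - 1))"
proof (rule asymp_equivI')
  have "c r \<noteq> 0" using euler_const_nonzero by (simp add: c_eq)
  have "((\<lambda>x. upto_sum (\<lambda>n. real_of_int (H r n)) x / (x * ln x ^ (2 ^ r - 1)) / c r) \<longlongrightarrow> c r / c r) at_top"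
    by (intro tendsto_divide upto_sum_H_tendsto assms tendsto_const \<open>c r \<noteq> 0\<close>)
  then show "((\<lambda>x. (\<Sum>n | 1 \<le> n \<and> real n \<le> x. real_of_int (H r n)) / (c r * x * ln x ^ (2 ^ r - 1))) \<longlongrightarrow> 1) at_top"
    using \<open>c r \<noteq> 0\<close> by (simp add: upto_sum_def mult_ac)
qed

end
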